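(* Let $\pi\in\mathrm{int}(I_j)$. Then $$\max\{v_1^*,\;v_\ell^*,\;V(B),\;v(\pi)\}\;\le\;\hat v(\pi)\;\le\;\hat v_b(\pi).$$
   Context: **Model.** The state space is $\Omega=\{0,1\}$ with common prior $\pi=\mathbf{P}(\omega=1)\in(0,1)$. The receiver has a finite action set $A=\{a_1,\dots,a_\ell\}$ and a utility $u_R:A\times\Omega\to\mathbb{R}$ and maximizes expected utility. There are cutoffs $0=x_0<x_1<\dots<x_\ell=1$ such that the set of beliefs (probabilities of $\omega=1$) at which $a_i$ is optimal is $I_i=[x_{i-1},x_i]$. The prior $\pi$ is fixed with $\pi\in\mathrm{int}(I_j)$. The sender has a state-independent utility $u_S:A\to\mathbb{R}$ (extended linearly to $\Delta(A)$) that is generic: $u_S(a)\neq u_S(b)$ for distinct $a,b\in A$. For a belief $\lambda$ in the interior of $I_i$, $v(\lambda)=u_S(a_i)$; in particular $v(\pi)=u_S(a_j)$. **Information structures.** An information structure $F=(S,F_0,F_1)$ consists of a measurable space $S$ and two mutually absolutely continuous probability measures $F_0,F_1$ on $S$ (the distribution of the receiver's private signal in each state). Each signal $s$ is identified with the posterior probability of $\omega=1$ that it induces starting from prior $1/2$, so $S\subseteq(0,1)$. With $lr(\lambda)=\log\frac{\lambda}{1-\lambda}$, a belief $\lambda$ is updated after signal $s$ to $\lambda^s$ with $lr(\lambda^s)=lr(\lambda)+lr(s)$. The sender does not observe the receiver's signal; message and signal are conditionally independent given $\omega$. For $\delta>0$, $\mathcal F_\delta$ is the set of all information structures with support contained in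 $[\frac12-\delta,\frac12+\delta]$, and $\mathcal B_\delta\subset\mathcal F_\delta$ is the set of those with binary support (two distinct signals). **Equilibrium.** A sender strategy is $\sigma:\Omega\to\Delta(M)$ with $M\subseteq[0,1]$ finite; a receiver strategy is a measurable $\rho:M\times S\to\Delta(A)$. Together with $F$ and $\pi$ they generate a distribution $p$ on $\Omega\times M\times S$; messages are identified with the posteriors they induce, $p(\omega=1|m)=m$. The pair $(\sigma,\rho)$ is a cheap-talk equilibrium if (1) the support of $\rho(m,s)$ is contained in $\arg\max_{a\in A}\,p(\omega=1|m,s)u_R(a,1)+p(\omega=0|m,s)u_R(a,0)$; and (2) for every $m\in M$ and $\omega\in\Omega$ with $p(m|\omega)>0$, $\int_S u_S(\rho(m,s))\,dF_\omega(s)\ge\int_S u_S(\rho(m',s))\,dF_\omega(s)$ for every $m'$ that is sent with positive probability. **Values.** $v^*_F(\pi)$ is the sender's maximal ex-ante expected utility over all cheap-talk equilibria with information structure $F$ and prior $\pi$. Define $\hat v(\pi)=\lim_{\delta\to0}\inf_{F\in\mathcal F_\delta}v^*_F(\pi)$ and $\hat v_b(\pi)=\lim_{\delta\to0}\inf_{F\in\mathcal B_\delta}v^*_F(\pi)$. **The set $Q$.** $Q$ is the set of quadruples $(a_i,a_{i+1},a_k,a_{k+1})\in A^4$ with $i\le j-1$, $k\ge j$, $i+1<k$ satisfying one of: 1. $u_S(a_i)<u_S(a_k)<u_S(a_{i+1})<u_S(a_{k+1})$; 2. $u_S(a_{k+1})<u_S(a_{i+1})<u_S(a_k)<u_S(a_i)$;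 3. $u_S(a_k)<u_S(a_i)<u_S(a_{k+1})<u_S(a_{i+1})$; 4. $u_S(a_{i+1})<u_S(a_{k+1})<u_S(a_i)<u_S(a_k)$. **The matrix $B$.** Write $Q=\{\overline a_1,\dots,\overline a_q\}$. $B$ is the $q\times2$ matrix in which, for $\overline a_l=(a_i,a_{i+1},a_k,a_{k+1})$ of type 1 or 2, $B_{l,1}=u_S(a_k)$ and $B_{l,2}=u_S(a_{i+1})$, and for $\overline a_l$ of type 3 or 4, $B_{l,1}=u_S(a_i)$ and $B_{l,2}=u_S(a_{k+1})$. $V(B)$ is the value of the zero-sum game with payoff matrix $B$ when the maximizing row player is restricted to pure strategies, i.e. $V(B)=\max_{1\le l\le q}\min\{B_{l,1},B_{l,2}\}$. If $Q=\emptyset$, set $V(B)=-\infty$. **The set $T$ and $v_1^*,v_\ell^*$.** $T$ is the set of triples, with $1<i<\ell$, of one of the forms: 1. $(a_1,a_i,a_{i+1})$ where $1<j\le i$ and $u_S(a_i)<u_S(a_1)<u_S(a_{i+1})$; 2. $(a_{i-1},a_i,a_\ell)$ where $i\le j<\ell$ and $u_S(a_i)<u_S(a_\ell)<u_S(a_{i-1})$. $u_S(a_1)$ (resp. $u_S(a_\ell)$) is achievable if $T$ contains a triple of type 1 (resp. type 2). For $i\in\{1,\ell\}$, $v_i^*=u_S(a_i)$ if $u_S(a_i)$ is achievable and $v_i^*=-\infty$ otherwise. *)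

theory Defs
  imports "HOL-Probability.Probability"
begin

text \<open>States are \<open>bool\<close>, with \<open>True\<close> for \<open>\<omega> = 1\<close>; a belief is the probability of \<open>True\<close>.
  The actions \<open>a\<^sub>1, \<dots>, a\<^sub>l\<close> are given by an enumeration \<open>a\<close> on \<open>{1..l}\<close>, and \<open>A = a ` {1..l}\<close>.\<close>

definition prior_prob :: "real \<Rightarrow> bool \<Rightarrow> real" where
  "prior_prob pr \<omega> = (if \<omega> then pr else 1 - pr)"

definition expected_uR :: "('a \<Rightarrow> bool \<Rightarrow> real) \<Rightarrow> real \<Rightarrow> 'a \<Rightarrow> real" where
  "expected_uR uR q b = q * uR b True + (1 - q) * uR b False"

definition optimal_actions :: "'a set \<Rightarrow> ('a \<Rightarrow> bool \<Rightarrow> real) \<Rightarrow> real \<Rightarrow> 'a set" where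
  "optimal_actions A uR q = {b. is_arg_max (expected_uR uR q) (\<lambda>b. b \<in> A) b}"

definition lr :: "real \<Rightarrow> real" where
  "lr q = ln (q / (1 - q))"

text \<open>Bayes' rule rather than the log-likelihood ratio identity \<open>lr_bayes_update\<close>, because
  messages may induce the beliefs 0 and 1, at which \<open>lr\<close> is infinite.\<close>

definition bayes_update :: "real \<Rightarrow> real \<Rightarrow> real" where
  "bayes_update q s = q * s / (q * s + (1 - q) * (1 - s))"

lemma lr_bayes_update:
  assumes "0 < q" "q < 1" "0 < s" "s < 1"
  shows "0 < bayes_update q s" "bayes_update q s < 1"
    and "lr (bayes_update q s) = lr q + lr s"
proof -
  have D: "q * s + (1 - q) * (1 - s) > 0" and qs: "q * s > 0" and n: "(1 - q) * (1 - s) > 0"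
    using assms by (simp_all add: add_pos_pos)
  show "0 < bayes_update q s" "bayes_update q s < 1"
    using D qs n by (simp_all add: bayes_update_def)
  have "1 - bayes_update q s = (1 - q) * (1 - s) / (q * s + (1 - q) * (1 - s))"
    using D unfolding bayes_update_def by (subst eq_divide_eq) (auto simp: left_diff_distrib)
  then have "bayes_update q s / (1 - bayes_update q s) = q / (1 - q) * (s / (1 - s))"
    using D by (simp add: bayes_update_def)
  moreover have "q / (1 - q) > 0" "s / (1 - s) > 0"
    using assms by simp_all
  ultimately show "lr (bayes_update q s) = lr q + lr s"
    by (simp only: lr_def ln_mult_pos)
qed

record info_structure =
  signals :: "real set"
  signal_dist :: "bool \<Rightarrow> real measure"

text \<open>The last conjunct identifies each signal with the posterior it induces from prior 1/2: under the
  joint law with prior 1/2, \<open>P(\<omega> = 1 \<and> s \<in> E) = E[s; s \<in> E]\<close>.\<close>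

definition is_info_structure :: "info_structure \<Rightarrow> bool" where
  "is_info_structure F \<longleftrightarrow>
     signals F \<subseteq> {0<..<1} \<and>
     (\<forall>\<omega>. prob_space (signal_dist F \<omega>) \<and>
          sets (signal_dist F \<omega>) = sets (restrict_space borel (signals F))) \<and>
     absolutely_continuous (signal_dist F False) (signal_dist F True) \<and>
     absolutely_continuous (signal_dist F True) (signal_dist F False) \<and>
     (\<forall>E \<in> sets (restrict_space borel (signals F)).
        prior_prob (1/2) True * measure (signal_dist F True) E
          = (\<Sum>\<omega>\<in>UNIV. prior_prob (1/2) \<omega> * (LINT s:E|signal_dist F \<omega>. s)))"

definition signal_support :: "info_structure \<Rightarrow> real set" where
  "signal_support F =
     {s \<in> signals F. \<forall>U. open U \<longrightarrow> s \<in> U \<longrightarrow> (\<forall>\<omega>. emeasure (signal_dist F \<omega>) (U \<inter> signals F) > 0)}"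

definition info_delta :: "real \<Rightarrow> info_structure set" where
  "info_delta \<delta> = {F. is_info_structure F \<and> signal_support F \<subseteq> {1/2 - \<delta> .. 1/2 + \<delta>}}"

definition binary_delta :: "real \<Rightarrow> info_structure set" where
  "binary_delta \<delta> = {F \<in> info_delta \<delta>. card (signal_support F) = 2}"

type_synonym sender_strategy = "bool \<Rightarrow> real pmf"
type_synonym 'a receiver_strategy = "real \<Rightarrow> real \<Rightarrow> 'a pmf"

definition message_prob :: "real \<Rightarrow> sender_strategy \<Rightarrow> real \<Rightarrow> real" where
  "message_prob pr \<sigma> m = (\<Sum>\<omega>\<in>UNIV. prior_prob pr \<omega> * pmf (\<sigma> \<omega>) m)"

definition message_posterior :: "real \<Rightarrow> sender_strategy \<Rightarrow> real \<Rightarrow> real" where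
  "message_posterior pr \<sigma> m = prior_prob pr True * pmf (\<sigma> True) m / message_prob pr \<sigma> m"

definition is_sender_strategy :: "real \<Rightarrow> real set \<Rightarrow> sender_strategy \<Rightarrow> bool" where
  "is_sender_strategy pr M \<sigma> \<longleftrightarrow>
     finite M \<and> M \<subseteq> {0..1} \<and> (\<forall>\<omega>. set_pmf (\<sigma> \<omega>) \<subseteq> M) \<and>
     (\<forall>m\<in>M. message_prob pr \<sigma> m > 0 \<longrightarrow> message_posterior pr \<sigma> m = m)"

definition is_receiver_strategy ::
    "'a set \<Rightarrow> info_structure \<Rightarrow> real set \<Rightarrow> 'a receiver_strategy \<Rightarrow> bool" where
  "is_receiver_strategy A F M \<rho> \<longleftrightarrow>
     (\<forall>m\<in>M. \<forall>s\<in>signals F. set_pmf (\<rho> m s) \<subseteq> A) \<and>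
     (\<forall>m\<in>M. \<forall>b\<in>A. (\<lambda>s. pmf (\<rho> m s) b) \<in> borel_measurable (restrict_space borel (signals F)))"

definition interim_payoff ::
    "('a \<Rightarrow> real) \<Rightarrow> info_structure \<Rightarrow> 'a receiver_strategy \<Rightarrow> bool \<Rightarrow> real \<Rightarrow> real" where
  "interim_payoff uS F \<rho> \<omega> m = (LINT s|signal_dist F \<omega>. measure_pmf.expectation (\<rho> m s) uS)"

definition ex_ante_payoff ::
    "('a \<Rightarrow> real) \<Rightarrow> info_structure \<Rightarrow> real \<Rightarrow> real set \<Rightarrow> sender_strategy \<Rightarrow> 'a receiver_strategy \<Rightarrow> real" where
  "ex_ante_payoff uS F pr M \<sigma> \<rho> =
     (\<Sum>\<omega>\<in>UNIV. prior_prob pr \<omega> * (\<Sum>m\<in>M. pmf (\<sigma> \<omega>) m * interim_payoff uS F \<rho> \<omega> m))"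

text \<open>By conditional independence of message and signal given the state, \<open>p(\<omega> = 1 | m, s)\<close> is the update
  of \<open>p(\<omega> = 1 | m)\<close> by \<open>s\<close>; it is only defined for messages of positive probability.\<close>

definition cheap_talk_equilibrium ::
    "'a set \<Rightarrow> ('a \<Rightarrow> bool \<Rightarrow> real) \<Rightarrow> ('a \<Rightarrow> real) \<Rightarrow> info_structure \<Rightarrow> real
       \<Rightarrow> real set \<Rightarrow> sender_strategy \<Rightarrow> 'a receiver_strategy \<Rightarrow> bool" where
  "cheap_talk_equilibrium A uR uS F pr M \<sigma> \<rho> \<longleftrightarrow>
     is_sender_strategy pr M \<sigma> \<and> is_receiver_strategy A F M \<rho> \<and>
     (\<forall>m\<in>M. message_prob pr \<sigma> m > 0 \<longrightarrow> (\<forall>s\<in>signals F.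
        set_pmf (\<rho> m s) \<subseteq> optimal_actions A uR (bayes_update (message_posterior pr \<sigma> m) s))) \<and>
     (\<forall>m\<in>M. \<forall>\<omega>. pmf (\<sigma> \<omega>) m > 0 \<longrightarrow> (\<forall>m'\<in>M. message_prob pr \<sigma> m' > 0 \<longrightarrow>
        interim_payoff uS F \<rho> \<omega> m \<ge> interim_payoff uS F \<rho> \<omega> m'))"

definition max_value ::
    "'a set \<Rightarrow> ('a \<Rightarrow> bool \<Rightarrow> real) \<Rightarrow> ('a \<Rightarrow> real) \<Rightarrow> info_structure \<Rightarrow> real \<Rightarrow> ereal" where
  "max_value A uR uS F pr =
     Sup {ereal (ex_ante_payoff uS F pr M \<sigma> \<rho>) | M \<sigma> \<rho>. cheap_talk_equilibrium A uR uS F pr M \<sigma> \<rho>}"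

definition v_hat :: "'a set \<Rightarrow> ('a \<Rightarrow> bool \<Rightarrow> real) \<Rightarrow> ('a \<Rightarrow> real) \<Rightarrow> real \<Rightarrow> ereal" where
  "v_hat A uR uS pr = Lim (at_right 0) (\<lambda>\<delta>. INF F\<in>info_delta \<delta>. max_value A uR uS F pr)"

definition v_hat_b :: "'a set \<Rightarrow> ('a \<Rightarrow> bool \<Rightarrow> real) \<Rightarrow> ('a \<Rightarrow> real) \<Rightarrow> real \<Rightarrow> ereal" where
  "v_hat_b A uR uS pr = Lim (at_right 0) (\<lambda>\<delta>. INF F\<in>binary_delta \<delta>. max_value A uR uS F pr)"

text \<open>Both limits exist, since the infima are monotone in \<open>\<delta>\<close>.\<close>

lemma tendsto_antimono_at_right_0:
  fixes f :: "real \<Rightarrow> ereal"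
  assumes "antimono f"
  shows "(f \<longlongrightarrow> (SUP \<delta>\<in>{0<..}. f \<delta>)) (at_right 0)"
proof (rule order_tendstoI)
  fix c assume "c < (SUP \<delta>\<in>{0<..}. f \<delta>)"
  then obtain d where d: "d > 0" "c < f d"
    by (auto simp: less_SUP_iff)
  have "eventually (\<lambda>\<delta>. \<delta> \<in> {0<..<d}) (at_right 0)"
    using d(1) by (rule eventually_at_right_real)
  then show "eventually (\<lambda>\<delta>. c < f \<delta>) (at_right 0)"
  proof (rule eventually_mono)
    fix \<delta> assume "\<delta> \<in> {0<..<d}"
    then have "f d \<le> f \<delta>" using antimonoD[OF assms, of \<delta> d] by simp
    with d(2) show "c < f \<delta>" by simp
  qed
next
  fix c assume c: "(SUP \<delta>\<in>{0<..}. f \<delta>) < c"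
  have "eventually (\<lambda>\<delta>::real. \<delta> \<in> {0<..}) (at_right 0)"
    by (simp add: eventually_at_right_less)
  then show "eventually (\<lambda>\<delta>. f \<delta> < c) (at_right 0)"
  proof (rule eventually_mono)
    fix \<delta> :: real assume "\<delta> \<in> {0<..}"
    then have "f \<delta> \<le> (SUP \<delta>\<in>{0<..}. f \<delta>)" by (rule SUP_upper)
    with c show "f \<delta> < c" by (rule le_less_trans[rotated])
  qed
qed

lemma info_delta_mono: "\<delta> \<le> \<epsilon> \<Longrightarrow> info_delta \<delta> \<subseteq> info_delta \<epsilon>"
  unfolding info_delta_def by fastforce

lemma binary_delta_mono: "\<delta> \<le> \<epsilon> \<Longrightarrow> binary_delta \<delta> \<subseteq> binary_delta \<epsilon>"
  unfolding binary_delta_def using info_delta_mono by blast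

lemma tendsto_v_hat:
  "((\<lambda>\<delta>. INF F\<in>info_delta \<delta>. max_value A uR uS F pr) \<longlongrightarrow> v_hat A uR uS pr) (at_right 0)"
proof -
  have "antimono (\<lambda>\<delta>. INF F\<in>info_delta \<delta>. max_value A uR uS F pr)"
    by (intro antimonoI INF_superset_mono info_delta_mono) auto
  from tendsto_antimono_at_right_0[OF this] show ?thesis
    unfolding v_hat_def by (metis tendsto_Lim trivial_limit_at_right_real)
qed

lemma tendsto_v_hat_b:
  "((\<lambda>\<delta>. INF F\<in>binary_delta \<delta>. max_value A uR uS F pr) \<longlongrightarrow> v_hat_b A uR uS pr) (at_right 0)"
proof -
  have "antimono (\<lambda>\<delta>. INF F\<in>binary_delta \<delta>. max_value A uR uS F pr)"
    by (intro antimonoI INF_superset_mono binary_delta_mono) auto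
  from tendsto_antimono_at_right_0[OF this] show ?thesis
    unfolding v_hat_b_def by (metis tendsto_Lim trivial_limit_at_right_real)
qed

text \<open>\<open>x\<close> lists the cutoffs. The value at a belief outside all the open intervals is unspecified.\<close>

definition v_belief :: "nat \<Rightarrow> (nat \<Rightarrow> 'a) \<Rightarrow> (nat \<Rightarrow> real) \<Rightarrow> ('a \<Rightarrow> real) \<Rightarrow> real \<Rightarrow> real" where
  "v_belief l a x uS q = uS (a (THE i. i \<in> {1..l} \<and> q \<in> interior {x (i - 1)..x i}))"

definition Q_type :: "('a \<Rightarrow> real) \<Rightarrow> nat \<Rightarrow> 'a \<times> 'a \<times> 'a \<times> 'a \<Rightarrow> bool" where
  "Q_type uS t = (\<lambda>(b, b', c, c').
     (t = 1 \<and> uS b < uS c \<and> uS c < uS b' \<and> uS b' < uS c') \<or>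
     (t = 2 \<and> uS c' < uS b' \<and> uS b' < uS c \<and> uS c < uS b) \<or>
     (t = 3 \<and> uS c < uS b \<and> uS b < uS c' \<and> uS c' < uS b') \<or>
     (t = 4 \<and> uS b' < uS c' \<and> uS c' < uS b \<and> uS b < uS c))"

definition Q_set :: "nat \<Rightarrow> (nat \<Rightarrow> 'a) \<Rightarrow> ('a \<Rightarrow> real) \<Rightarrow> nat \<Rightarrow> ('a \<times> 'a \<times> 'a \<times> 'a) set" where
  "Q_set l a uS j =
     {(a i, a (i + 1), a k, a (k + 1)) | i k.
        1 \<le> i \<and> i \<le> j - 1 \<and> j \<le> k \<and> k + 1 \<le> l \<and> i + 1 < k \<and>
        (\<exists>t\<in>{1..4}. Q_type uS t (a i, a (i + 1), a k, a (k + 1)))}"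

text \<open>The rows of the matrix are indexed by the quadruples themselves, the columns by 1 and 2.\<close>

definition B_matrix :: "('a \<Rightarrow> real) \<Rightarrow> 'a \<times> 'a \<times> 'a \<times> 'a \<Rightarrow> nat \<Rightarrow> real" where
  "B_matrix uS r n = (case r of (b, b', c, c') \<Rightarrow>
     if Q_type uS 1 r \<or> Q_type uS 2 r
     then (if n = 1 then uS c else uS b')
     else (if n = 1 then uS b else uS c'))"

definition pure_row_value :: "'r set \<Rightarrow> ('r \<Rightarrow> nat \<Rightarrow> real) \<Rightarrow> ereal" where
  "pure_row_value R B =
     (if R = {} then -\<infinity> else ereal (Max ((\<lambda>r. min (B r 1) (B r 2)) ` R)))"

definition V_B :: "nat \<Rightarrow> (nat \<Rightarrow> 'a) \<Rightarrow> ('a \<Rightarrow> real) \<Rightarrow> nat \<Rightarrow> ereal" where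
  "V_B l a uS j = pure_row_value (Q_set l a uS j) (B_matrix uS)"

definition T_type1 :: "nat \<Rightarrow> (nat \<Rightarrow> 'a) \<Rightarrow> ('a \<Rightarrow> real) \<Rightarrow> nat \<Rightarrow> ('a \<times> 'a \<times> 'a) set" where
  "T_type1 l a uS j =
     {(a 1, a i, a (i + 1)) | i. 1 < i \<and> i < l \<and> 1 < j \<and> j \<le> i \<and>
        uS (a i) < uS (a 1) \<and> uS (a 1) < uS (a (i + 1))}"

definition T_type2 :: "nat \<Rightarrow> (nat \<Rightarrow> 'a) \<Rightarrow> ('a \<Rightarrow> real) \<Rightarrow> nat \<Rightarrow> ('a \<times> 'a \<times> 'a) set" where
  "T_type2 l a uS j =
     {(a (i - 1), a i, a l) | i. 1 < i \<and> i < l \<and> i \<le> j \<and> j < l \<and>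
        uS (a i) < uS (a l) \<and> uS (a l) < uS (a (i - 1))}"

definition v_first_star :: "nat \<Rightarrow> (nat \<Rightarrow> 'a) \<Rightarrow> ('a \<Rightarrow> real) \<Rightarrow> nat \<Rightarrow> ereal" where
  "v_first_star l a uS j = (if T_type1 l a uS j \<noteq> {} then ereal (uS (a 1)) else -\<infinity>)"

definition v_last_star :: "nat \<Rightarrow> (nat \<Rightarrow> 'a) \<Rightarrow> ('a \<Rightarrow> real) \<Rightarrow> nat \<Rightarrow> ereal" where
  "v_last_star l a uS j = (if T_type2 l a uS j \<noteq> {} then ereal (uS (a l)) else -\<infinity>)"

end

theory Submission
  imports Defs
begin

text \<open>
  Each lower bound comes from an explicit equilibrium that exists for every sufficiently
  uninformative structure. A message whose posterior lies near the cutoff between \<open>a\<^sub>i\<close> and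
  \<open>a\<^sub>i\<^sub>+\<^sub>1\<close> makes the receiver play a threshold rule, and by shifting the posterior (and mixing at
  the threshold) the sender can pick any threshold. The pairs of state-contingent acceptance
  probabilities then sweep out the ROC curve of the signal, a continuous curve from (0,0) to (1,1)
  above the diagonal. For a quadruple in \<open>Q\<close>, two rescaled copies of this curve start and end at
  interleaved points of the diagonal, so they cross; at the crossing the sender is indifferent
  between the two messages in both states. For a triple in \<open>T\<close>, one message reveals a state and the
  other is tuned to make the sender indifferent in that state; as the ROC curve lies above the
  diagonal, the other state prefers not to reveal.
\<close>

section \<open>Threshold rules and the ROC curve\<close>

text \<open>\<open>thr t \<alpha>\<close> randomises at the threshold itself, so that atoms of the signal
  distribution do not create gaps in the range of acceptance probabilities.\<close>

definition thr :: "real \<Rightarrow> real \<Rightarrow> real \<Rightarrow> real" where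
  "thr t \<alpha> s = (if t < s then 1 else if s = t then \<alpha> else 0)"

lemma thr_measurable [measurable]: "thr t \<alpha> \<in> borel_measurable borel"
  unfolding thr_def by measurable

lemma thr_bounds: "\<alpha> \<in> {0..1} \<Longrightarrow> 0 \<le> thr t \<alpha> s \<and> thr t \<alpha> s \<le> 1"
  by (simp add: thr_def)

text \<open>Rules are ordered lexicographically, by falling threshold and then by rising weight.
  Because this order is total, the difference of two rules never changes sign.\<close>

lemma thr_linear:
  assumes "\<alpha> \<in> {0..1}" "\<beta> \<in> {0..1}"
  shows "(\<forall>s. thr t \<alpha> s \<le> thr u \<beta> s) \<or> (\<forall>s. thr u \<beta> s \<le> thr t \<alpha> s)"
  using assms by (cases "t = u \<longrightarrow> \<alpha> \<le> \<beta>"; cases t u rule: linorder_cases) (auto simp: thr_def)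

text \<open>Both curves are parametrised by their first coordinate \<open>y\<close> over the overlap
  \<open>{c..b'}\<close>. At \<open>y = c\<close> the second curve starts on the diagonal while the
  first is on or above it; at \<open>y = b'\<close> the first ends on the diagonal and the second is
  on or above it. The intermediate value theorem gives the crossing.\<close>

lemma interleaved_curves_cross:
  fixes g :: "real \<Rightarrow> real"
  assumes g: "continuous_on {0..1} g" "g 1 = 1" "\<And>p. p \<in> {0..1} \<Longrightarrow> p \<le> g p"
    and g0: "g 0 = 0"
    and ord: "b < c" "c < b'" "b' < c'"
  shows "\<exists>p\<in>{0..1}. \<exists>q\<in>{0..1}. b + p * (b' - b) = c + q * (c' - c) \<and>
           b + g p * (b' - b) = c + g q * (c' - c)"
proof -
  let ?P = "\<lambda>y. (y - b) / (b' - b)" and ?Q = "\<lambda>y. (y - c) / (c' - c)"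
  let ?h = "\<lambda>y. (b + g (?P y) * (b' - b)) - (c + g (?Q y) * (c' - c))"
  have P: "?P y \<in> {0..1}" and Q: "?Q y \<in> {0..1}" if "y \<in> {c..b'}" for y
    using that ord by auto
  have "continuous_on {c..b'} ?h"
    using P Q ord
    by (intro continuous_intros continuous_on_compose2[OF g(1)]) auto
  moreover have "0 \<le> ?h c"
  proof -
    have "?P c * (b' - b) \<le> g (?P c) * (b' - b)"
      using g(3)[OF P[of c]] ord by (intro mult_right_mono) auto
    then show ?thesis using ord g0 by simp
  qed
  moreover have "?h b' \<le> 0"
  proof -
    have "?Q b' * (c' - c) \<le> g (?Q b') * (c' - c)"
      using g(3)[OF Q[of b']] ord by (intro mult_right_mono) auto
    then show ?thesis using ord g(2) by simp
  qed
  ultimately obtain y where "c \<le> y" "y \<le> b'" "?h y = 0"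
    using IVT2'[of ?h b' 0 c] ord by auto
  then show ?thesis
    using P[of y] Q[of y] ord by (intro bexI[of _ "?P y"] bexI[of _ "?Q y"]) auto
qed

text \<open>The four cases are the order patterns of types 1 to 4 in \<open>Q_type\<close>. In each,
  the segments from \<open>b\<close> to \<open>b'\<close> and from \<open>c\<close> to
  \<open>c'\<close> point the same way and overlap, and neither contains the other.\<close>

definition interleaved :: "real \<Rightarrow> real \<Rightarrow> real \<Rightarrow> real \<Rightarrow> bool" where
  "interleaved b b' c c' \<longleftrightarrow>
     (b < c \<and> c < b' \<and> b' < c') \<or> (c' < b' \<and> b' < c \<and> c < b) \<or>
     (c < b \<and> b < c' \<and> c' < b') \<or> (b' < c' \<and> c' < b \<and> b < c)"

section \<open>Signal laws supported near 1/2 and their likelihood ratio\<close>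

locale small_info =
  fixes F :: info_structure and \<delta> :: real
  assumes info: "F \<in> info_delta \<delta>" and \<delta>: "0 < \<delta>" "\<delta> \<le> 1/8"
begin

abbreviation D :: "bool \<Rightarrow> real measure" where "D \<equiv> signal_dist F"

lemma prob_space_D: "prob_space (D \<omega>)"
  using info by (simp add: info_delta_def is_info_structure_def)

sublocale D: prob_space "D \<omega>" for \<omega>
  by (rule prob_space_D)

lemma sets_D [measurable_cong]: "sets (D \<omega>) = sets (restrict_space borel (signals F))"
  using info by (simp add: info_delta_def is_info_structure_def)

lemma space_D: "space (D \<omega>) = signals F"
  using sets_eq_imp_space_eq[OF sets_D] by (simp add: space_restrict_space)

lemma borel_measurable_D:
  "f \<in> borel_measurable borel \<Longrightarrow> f \<in> borel_measurable (D \<omega>)"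
  by (simp add: measurable_cong_sets[OF sets_D refl] measurable_restrict_space1)

lemma id_measurable_D [measurable]: "(\<lambda>s. s) \<in> borel_measurable (D \<omega>)"
  by (rule borel_measurable_D) simp

lemma thr_measurable_D [measurable]: "thr t \<alpha> \<in> borel_measurable (D \<omega>)"
  by (rule borel_measurable_D) simp

lemma signal_in_01: "s \<in> signals F \<Longrightarrow> 0 < s \<and> s < 1"
  using info by (auto simp: info_delta_def is_info_structure_def)

lemma AE_signal: "AE s in D \<omega>. 0 < s \<and> s < 1"
  by (rule AE_I2) (simp add: space_D signal_in_01)

lemma null_sets_D_eq: "null_sets (D \<omega>) = null_sets (D \<omega>')"
proof -
  have "null_sets (D True) = null_sets (D False)"
    using info by (auto simp: info_delta_def is_info_structure_def absolutely_continuous_def)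
  then show ?thesis by (cases \<omega>; cases \<omega>') auto
qed

text \<open>A signal outside the support has a neighbourhood that is null in some state, hence in
  both by mutual absolute continuity. Lindelof's theorem covers all such signals by countably many
  of these neighbourhoods.\<close>

lemma AE_support: "AE s in D \<omega>. s \<in> {1/2 - \<delta>..1/2 + \<delta>}"
proof -
  define \<U> where "\<U> = {U. open U \<and> U \<inter> signals F \<in> null_sets (D \<omega>)}"
  obtain \<V> where \<V>: "\<V> \<subseteq> \<U>" "countable \<V>" "\<Union>\<V> = \<Union>\<U>"
    using Lindelof[of \<U>] by (auto simp: \<U>_def)
  have "(\<Union>U\<in>\<V>. U \<inter> signals F) \<in> null_sets (D \<omega>)"
    using \<V>(1,2) by (intro null_sets_UN') (auto simp: \<U>_def)
  moreover have "{s \<in> space (D \<omega>). s \<notin> {1/2 - \<delta>..1/2 + \<delta>}} \<subseteq> (\<Union>U\<in>\<V>. U \<inter> signals F)"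
  proof
    fix s assume "s \<in> {s \<in> space (D \<omega>). s \<notin> {1/2 - \<delta>..1/2 + \<delta>}}"
    then have s: "s \<in> signals F" "s \<notin> signal_support F"
      using info by (auto simp: space_D info_delta_def)
    then obtain U \<omega>' where U: "open U" "s \<in> U" "emeasure (D \<omega>') (U \<inter> signals F) = 0"
      unfolding signal_support_def using not_gr_zero by blast
    have "U \<inter> signals F \<in> sets (D \<omega>')"
      using U(1) by (auto simp: sets_D sets_restrict_space)
    then have "U \<inter> signals F \<in> null_sets (D \<omega>)"
      using U(3) null_sets_D_eq by blast
    then have "s \<in> \<Union>\<U>"
      using U by (auto simp: \<U>_def)
    then show "s \<in> (\<Union>U\<in>\<V>. U \<inter> signals F)"
      using \<V>(3) s(1) by auto
  qed
  ultimately show ?thesis by (rule AE_I')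
qed

lemma AE_supportI:
  "(\<And>s. s \<in> {1/2 - \<delta>..1/2 + \<delta>} \<Longrightarrow> P s) \<Longrightarrow> AE s in D \<omega>. P s"
  using AE_support[of \<omega>] by (rule eventually_mono)

lemma bounded_integrable:
  fixes f :: "real \<Rightarrow> real"
  assumes "f \<in> borel_measurable borel" "\<And>s. 0 < s \<Longrightarrow> s < 1 \<Longrightarrow> \<bar>f s\<bar> \<le> B"
  shows "integrable (D \<omega>) f"
proof (rule D.integrable_const_bound)
  show "AE s in D \<omega>. norm (f s) \<le> B"
    using AE_signal by eventually_elim (simp add: assms(2))
qed (rule borel_measurable_D[OF assms(1)])

text \<open>Signals are calibrated posteriors from prior 1/2, so the mass of \<open>E\<close> under
  \<open>D True\<close> is the sum over both states of the integral of \<open>s\<close> over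
  \<open>E\<close>. The claim is a rearrangement of this.\<close>

lemma likelihood_set:
  assumes E: "E \<in> sets (D \<omega>)"
  shows "(LINT s:E|D True. 1 - s) = (LINT s:E|D False. s)"
proof -
  have "measure (D True) E = (LINT s:E|D True. s) + (LINT s:E|D False. s)"
    using info E unfolding sets_D
    by (auto simp: info_delta_def is_info_structure_def prior_prob_def UNIV_bool)
  moreover have "(LINT s:E|D True. 1 - s) = (LINT s:E|D True. 1) - (LINT s:E|D True. s)"
  proof (rule set_integral_diff)
    have E': "E \<in> sets (D True)" using E by (simp add: sets_D)
    show "set_integrable (D True) E (\<lambda>s. 1)"
      using E' by (simp add: set_integrable_def D.emeasure_eq_measure)
    show "set_integrable (D True) E (\<lambda>s. s)"
      unfolding set_integrable_def
      by (rule integrable_mult_indicator[OF E'], rule bounded_integrable[where B = 1]) simp_all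
  qed
  moreover have "(LINT s:E|D True. 1) = measure (D True) E"
    using E by (simp add: set_lebesgue_integral_def sets_D)
  ultimately show ?thesis by simp
qed

text \<open>The likelihood ratio of a signal \<open>s\<close> is \<open>s / (1 - s)\<close>.\<close>

lemma density_D_eq: "density (D True) (\<lambda>s. ennreal (1 - s)) = density (D False) (\<lambda>s. ennreal s)"
proof (rule measure_eqI)
  show "sets (density (D True) (\<lambda>s. ennreal (1 - s))) = sets (density (D False) (\<lambda>s. ennreal s))"
    by (simp add: sets_D)
next
  fix E assume "E \<in> sets (density (D True) (\<lambda>s. ennreal (1 - s)))"
  then have E: "E \<in> sets (D \<omega>)" for \<omega> by (simp add: sets_D)
  have *: "emeasure (density (D \<omega>) (\<lambda>s. ennreal (f s))) E = ennreal (LINT s:E|D \<omega>. f s)"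
    if f: "f \<in> borel_measurable borel" "\<And>s. 0 < s \<Longrightarrow> s < 1 \<Longrightarrow> 0 \<le> f s \<and> f s \<le> 1" for f \<omega>
  proof -
    have "emeasure (density (D \<omega>) (\<lambda>s. ennreal (f s))) E = (\<integral>\<^sup>+s. ennreal (f s) * indicator E s \<partial>D \<omega>)"
      using f(1) E by (intro emeasure_density) (auto intro: borel_measurable_D)
    also have "\<dots> = (\<integral>\<^sup>+s. ennreal (indicator E s *\<^sub>R f s) \<partial>D \<omega>)"
      by (intro nn_integral_cong) (auto simp: indicator_def)
    also have "\<dots> = ennreal (LINT s:E|D \<omega>. f s)"
      unfolding set_lebesgue_integral_def
    proof (rule nn_integral_eq_integral)
      show "integrable (D \<omega>) (\<lambda>s. indicator E s *\<^sub>R f s)"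
        using E f by (intro integrable_mult_indicator bounded_integrable[where B = 1]) auto
      show "AE s in D \<omega>. 0 \<le> indicator E s *\<^sub>R f s"
        using AE_signal by eventually_elim (simp add: f(2) indicator_def)
    qed
    finally show ?thesis .
  qed
  show "emeasure (density (D True) (\<lambda>s. ennreal (1 - s))) E
      = emeasure (density (D False) (\<lambda>s. ennreal s)) E"
    by (subst (1 2) *) (auto simp: likelihood_set[OF E])
qed

text \<open>Change of measure between the states, in a form without division by \<open>s\<close> or
  \<open>1 - s\<close>.\<close>

lemma likelihood_integral:
  assumes f: "f \<in> borel_measurable borel"
  shows "(LINT s|D True. (1 - s) * f s) = (LINT s|D False. s * f s)"
proof -
  have "(LINT s|D True. (1 - s) *\<^sub>R f s) = integral\<^sup>L (density (D True) (\<lambda>s. 1 - s)) f"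
    using f AE_signal[of True]
    by (intro integral_density[symmetric]) (auto intro: borel_measurable_D elim: eventually_mono)
  also have "\<dots> = (LINT s|D False. s *\<^sub>R f s)"
    unfolding density_D_eq using f AE_signal[of False]
    by (intro integral_density) (auto intro: borel_measurable_D elim: eventually_mono)
  finally show ?thesis by simp
qed

text \<open>In testing terms, \<open>tail False\<close> is the size and \<open>tail True\<close> the
  power of the randomised likelihood ratio test \<open>thr t \<alpha>\<close>; the pair is a point
  of the ROC curve.\<close>

definition tail :: "bool \<Rightarrow> real \<Rightarrow> real \<Rightarrow> real" where
  "tail \<omega> t \<alpha> = (LINT s|D \<omega>. thr t \<alpha> s)"

lemma thr_integrable: "\<alpha> \<in> {0..1} \<Longrightarrow> integrable (D \<omega>) (thr t \<alpha>)"
  by (rule bounded_integrable[where B = 1]) (auto simp: thr_def)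

lemma tail_bounds:
  assumes "\<alpha> \<in> {0..1}" shows "tail \<omega> t \<alpha> \<in> {0..1}"
proof -
  have "tail \<omega> t \<alpha> \<le> 1" "0 \<le> tail \<omega> t \<alpha>"
    unfolding tail_def using thr_bounds[OF assms] thr_integrable[OF assms]
    by (auto intro!: D.integral_le_const integral_nonneg_AE)
  then show ?thesis by simp
qed

text \<open>Where \<open>f\<close> is nonzero the likelihood ratio lies between those of
  \<open>lo\<close> and \<open>hi\<close>, and integration preserves this. The cross-multiplied form
  admits the trivial bounds \<open>lo = 0\<close> and \<open>hi = 1\<close>.\<close>

lemma likelihood_bound:
  assumes f: "f \<in> borel_measurable borel" and b: "\<And>s. 0 \<le> f s \<and> f s \<le> 1"
    and c: "\<And>s. f s \<noteq> 0 \<Longrightarrow> s \<in> {1/2 - \<delta>..1/2 + \<delta>} \<Longrightarrow> s \<in> {lo..hi}"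
  shows "lo * (LINT s|D False. f s) \<le> (1 - lo) * (LINT s|D True. f s)"
    and "(1 - hi) * (LINT s|D True. f s) \<le> hi * (LINT s|D False. f s)"
proof -
  have prod: "\<bar>x * f s\<bar> \<le> 1" if "0 < x" "x < 1" for x s
    using b[of s] that mult_mono[of x 1 "f s" 1] by (simp add: abs_mult)
  have int: "integrable (D \<omega>) f" "integrable (D \<omega>) (\<lambda>s. s * f s)" "integrable (D \<omega>) (\<lambda>s. (1 - s) * f s)" for \<omega>
  proof -
    have "\<bar>f s\<bar> \<le> 1" for s using b[of s] by simp
    then show "integrable (D \<omega>) f" "integrable (D \<omega>) (\<lambda>s. s * f s)" "integrable (D \<omega>) (\<lambda>s. (1 - s) * f s)"
      using f by (rule_tac [!] bounded_integrable[where B = 1])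
        (use prod in \<open>auto intro!: borel_measurable_times\<close>)
  qed
  have pt: "lo * f s \<le> s * f s" "s * f s \<le> hi * f s" if "s \<in> {1/2 - \<delta>..1/2 + \<delta>}" for s
    using b[of s] c[of s] that by (cases "f s = 0"; auto intro: mult_right_mono)+
  have "lo * (LINT s|D False. f s) = (LINT s|D False. lo * f s)" by simp
  also have "\<dots> \<le> (LINT s|D False. s * f s)"
    using int by (intro integral_mono_AE AE_supportI) (auto simp: pt)
  also have "\<dots> = (LINT s|D True. (1 - s) * f s)"
    using likelihood_integral[OF f] by simp
  also have "\<dots> \<le> (LINT s|D True. (1 - lo) * f s)"
    using int by (intro integral_mono_AE AE_supportI) (auto simp: pt left_diff_distrib)
  finally show "lo * (LINT s|D False. f s) \<le> (1 - lo) * (LINT s|D True. f s)" by simp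
  have "(1 - hi) * (LINT s|D True. f s) = (LINT s|D True. (1 - hi) * f s)" by simp
  also have "\<dots> \<le> (LINT s|D True. (1 - s) * f s)"
    using int by (intro integral_mono_AE AE_supportI) (auto simp: pt left_diff_distrib)
  also have "\<dots> = (LINT s|D False. s * f s)"
    by (rule likelihood_integral[OF f])
  also have "\<dots> \<le> (LINT s|D False. hi * f s)"
    using int by (intro integral_mono_AE AE_supportI) (auto simp: pt)
  finally show "(1 - hi) * (LINT s|D True. f s) \<le> hi * (LINT s|D False. f s)" by simp
qed

text \<open>For a threshold of at least 1/2, all accepted signals favour \<open>True\<close>; for a
  lower one, all rejected signals favour \<open>False\<close>. So the likelihood bound is applied to
  the rule or to its complement.\<close>

lemma tail_False_le_True:
  assumes \<alpha>: "\<alpha> \<in> {0..1}"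
  shows "tail False t \<alpha> \<le> tail True t \<alpha>"
proof (cases "1/2 \<le> t")
  case True
  have "1/2 * (LINT s|D False. thr t \<alpha> s) \<le> (1 - 1/2) * (LINT s|D True. thr t \<alpha> s)"
    using True thr_bounds[OF \<alpha>]
    by (intro likelihood_bound(1)[where hi = 1]) (use \<delta> in \<open>auto simp: thr_def split: if_splits\<close>)
  then show ?thesis by (simp add: tail_def)
next
  case False
  have "(1 - 1/2) * (LINT s|D True. 1 - thr t \<alpha> s) \<le> 1/2 * (LINT s|D False. 1 - thr t \<alpha> s)"
    using False thr_bounds[OF \<alpha>]
    by (intro likelihood_bound(2)[where lo = 0]) (use \<delta> in \<open>auto simp: thr_def split: if_splits\<close>)
  moreover have "(LINT s|D \<omega>. 1 - thr t \<alpha> s) = 1 - tail \<omega> t \<alpha>" for \<omega>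
    by (simp add: tail_def thr_integrable[OF \<alpha>] D.prob_space)
  ultimately show ?thesis by simp
qed

text \<open>Slopes of the ROC curve are likelihood ratios, which are bounded on the support. This
  gives continuity of the curve and shows that rules with equal size have equal power.\<close>

lemma tail_lipschitz:
  assumes \<alpha>: "\<alpha> \<in> {0..1}" and \<beta>: "\<beta> \<in> {0..1}"
  shows "\<bar>tail True t \<alpha> - tail True u \<beta>\<bar> \<le> 2 * \<bar>tail False t \<alpha> - tail False u \<beta>\<bar>"
proof -
  have *: "0 \<le> tail True t' \<alpha>' - tail True u' \<beta>' \<and>
      tail True t' \<alpha>' - tail True u' \<beta>' \<le> 2 * (tail False t' \<alpha>' - tail False u' \<beta>')"
    if a: "\<alpha>' \<in> {0..1}" "\<beta>' \<in> {0..1}" and le: "\<And>s. thr u' \<beta>' s \<le> thr t' \<alpha>' s" for t' \<alpha>' u' \<beta>'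
  proof -
    let ?f = "\<lambda>s. thr t' \<alpha>' s - thr u' \<beta>' s"
    have b: "0 \<le> ?f s \<and> ?f s \<le> 1" for s
      using le[of s] thr_bounds[OF a(1), of t' s] thr_bounds[OF a(2), of u' s] by linarith
    have f: "?f \<in> borel_measurable borel" by measurable
    \<comment> \<open>Signals in the support are at most 1/2 + 1/8 = 5/8, so the likelihood ratio is
      at most 5/3, which is below 2.\<close>
    have le: "(1 - 5/8) * (LINT s|D True. ?f s) \<le> 5/8 * (LINT s|D False. ?f s)"
      by (rule likelihood_bound(2)[OF f b, where lo = 0]) (use \<delta> in auto)
    have nonneg: "0 \<le> (LINT s|D \<omega>. ?f s)" for \<omega>
      using b by (intro integral_nonneg_AE) auto
    have diff: "(LINT s|D \<omega>. ?f s) = tail \<omega> t' \<alpha>' - tail \<omega> u' \<beta>'" for \<omega>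
      unfolding tail_def by (intro Bochner_Integration.integral_diff thr_integrable a)
    show ?thesis
      using le nonneg[of True] nonneg[of False] unfolding diff by argo
  qed
  show ?thesis
    using thr_linear[OF \<alpha> \<beta>, of t u] *[OF \<alpha> \<beta>, of u t] *[OF \<beta> \<alpha>, of t u] by (elim disjE) auto
qed

text \<open>The mixing weight interpolates between the strict and the weak tail, so it fills the
  jump caused by an atom at \<open>t\<close>.\<close>

lemma tail_eq:
  assumes "\<alpha> \<in> {0..1}"
  shows "tail \<omega> t \<alpha> = (1 - \<alpha>) * measure (D \<omega>) {s \<in> signals F. t < s}
                     + \<alpha> * measure (D \<omega>) {s \<in> signals F. t \<le> s}"
proof -
  have meas: "{s \<in> signals F. t < s} \<in> sets (D \<omega>)" "{s \<in> signals F. t \<le> s} \<in> sets (D \<omega>)"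
    unfolding space_D[of \<omega>, symmetric] by measurable
  have "tail \<omega> t \<alpha> = (LINT s|D \<omega>. (1 - \<alpha>) * indicator {s \<in> signals F. t < s} s
                     + \<alpha> * indicator {s \<in> signals F. t \<le> s} s)"
    unfolding tail_def
    by (intro Bochner_Integration.integral_cong) (auto simp: thr_def space_D indicator_def)
  also have "\<dots> = (LINT s|D \<omega>. (1 - \<alpha>) * indicator {s \<in> signals F. t < s} s)
                     + (LINT s|D \<omega>. \<alpha> * indicator {s \<in> signals F. t \<le> s} s)"
    using meas by (intro Bochner_Integration.integral_add) (auto simp: D.emeasure_eq_measure)
  finally show ?thesis using meas by (simp add: sets.Int_space_eq2)
qed

text \<open>The threshold is a quantile of the signal and the weight resolves the jump there. The
  levels 0 and 1 are reached at the ends of the support interval and are treated apart, since the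
  quantile function is used only for levels strictly between.\<close>

lemma tail_surj:
  assumes p: "p \<in> {0..1}"
  obtains t \<alpha> where "t \<in> {1/2 - \<delta>..1/2 + \<delta>}" "\<alpha> \<in> {0..1}" "tail \<omega> t \<alpha> = p"
proof -
  have ends: "tail \<omega> (1/2 + \<delta>) 0 = 0" "tail \<omega> (1/2 - \<delta>) 1 = 1"
  proof -
    have "tail \<omega> (1/2 + \<delta>) 0 = (LINT s|D \<omega>. 0)" unfolding tail_def
      by (intro integral_cong_AE AE_supportI) (use \<delta> in \<open>auto simp: thr_def\<close>)
    then show "tail \<omega> (1/2 + \<delta>) 0 = 0" by simp
    have "tail \<omega> (1/2 - \<delta>) 1 = (LINT s|D \<omega>. 1)" unfolding tail_def
      by (intro integral_cong_AE AE_supportI) (use \<delta> in \<open>auto simp: thr_def\<close>)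
    then show "tail \<omega> (1/2 - \<delta>) 1 = 1" by (simp add: D.prob_space)
  qed
  consider "p = 0" | "p = 1" | "0 < p" "p < 1" using p by fastforce
  then show thesis
  proof cases
    case 1 then show thesis using that[of "1/2 + \<delta>" 0] ends \<delta> by simp
  next
    case 2 then show thesis using that[of "1/2 - \<delta>" 1] ends \<delta> by simp
  next
    case 3
    \<comment> \<open>Negating the signal turns weak upper tails into values of a distribution
      function and strict upper tails into its left limits.\<close>
    define N where "N = distr (D \<omega>) borel uminus"
    interpret N: cdf_distribution N
      unfolding cdf_distribution_def N_def by (intro D.real_distribution_distr) measurable
    have cdf: "cdf N y = tail \<omega> (- y) 1" for y
    proof -
      have "cdf N y = measure (D \<omega>) (uminus -` {..y} \<inter> space (D \<omega>))"
        unfolding cdf_def N_def by (rule measure_distr) auto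
      also have "uminus -` {..y} \<inter> space (D \<omega>) = {s \<in> signals F. - y \<le> s}"
        by (auto simp: space_D)
      finally show ?thesis by (simp add: tail_eq)
    qed
    have left: "measure N {..<y} = tail \<omega> (- y) 0" for y
    proof -
      have "measure N {..<y} = measure (D \<omega>) (uminus -` {..<y} \<inter> space (D \<omega>))"
        unfolding N_def by (rule measure_distr) auto
      also have "uminus -` {..<y} \<inter> space (D \<omega>) = {s \<in> signals F. - y < s}"
        by (auto simp: space_D)
      finally show ?thesis by (simp add: tail_eq)
    qed
    \<comment> \<open>At this quantile the left limit is at most \<open>p\<close> and the value is
      at least \<open>p\<close>, so some weight hits \<open>p\<close> exactly.\<close>
    define y where "y = N.I p"
    have le: "p \<le> cdf N z \<longleftrightarrow> y \<le> z" for z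
      unfolding y_def using 3 by (rule N.pseudoinverse)
    have upper: "p \<le> tail \<omega> (- y) 1" using le[of y] cdf by simp
    have "measure N {..<y} \<le> p"
    proof (rule tendsto_upperbound[OF N.cdf_at_left])
      show "\<forall>\<^sub>F z in at_left y. cdf N z \<le> p"
        using le by (auto simp: eventually_at_filter intro!: always_eventually) (meson linorder_not_le less_imp_le)
    qed simp
    then have lower: "tail \<omega> (- y) 0 \<le> p" using left by simp
    have "y \<le> - (1/2 - \<delta>)" using le[of "- (1/2 - \<delta>)"] cdf[of "- (1/2 - \<delta>)"] ends 3 by simp
    moreover have "- (1/2 + \<delta>) \<le> y"
    proof (rule ccontr)
      assume "\<not> ?thesis"
      \<comment> \<open>The midpoint of \<open>y\<close> and \<open>- (1/2 + \<delta>)\<close>: the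
        threshold \<open>- z\<close> lies strictly above the support, so even the weak tail vanishes
        there, against \<open>0 < p\<close>.\<close>
      moreover define z where "z = (y - (1/2 + \<delta>)) / 2"
      ultimately have z: "y \<le> z" "1/2 + \<delta> < - z" by (auto simp: field_simps)
      have "tail \<omega> (- z) 1 = (LINT s|D \<omega>. 0)" unfolding tail_def
        by (intro integral_cong_AE AE_supportI) (use z \<delta> in \<open>auto simp: thr_def\<close>)
      then show False using le[of z] cdf[of z] z(1) 3 by simp
    qed
    moreover obtain \<alpha> where \<alpha>: "\<alpha> \<in> {0..1}" "tail \<omega> (- y) \<alpha> = p"
    proof -
      let ?h = "\<lambda>\<alpha>. (1 - \<alpha>) * tail \<omega> (- y) 0 + \<alpha> * tail \<omega> (- y) 1"
      have "\<exists>\<alpha>\<ge>0. \<alpha> \<le> 1 \<and> ?h \<alpha> = p"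
        using upper lower by (intro IVT') (auto intro!: continuous_intros)
      then show thesis using that by (auto simp: tail_eq)
    qed
    ultimately show thesis using that[of "- y" \<alpha>] by simp
  qed
qed

text \<open>The payoff pairs of the two messages run through affine images of the same ROC curve,
  written as the graph of \<open>g\<close>. A crossing point of the images equalises the payoffs in
  both states at once.\<close>

lemma indifferent_thresholds:
  assumes "interleaved b b' c c'"
  obtains t \<alpha> u \<beta> where "t \<in> {1/2 - \<delta>..1/2 + \<delta>}" "\<alpha> \<in> {0..1}" "u \<in> {1/2 - \<delta>..1/2 + \<delta>}" "\<beta> \<in> {0..1}"
    "\<And>\<omega>. b + tail \<omega> t \<alpha> * (b' - b) = c + tail \<omega> u \<beta> * (c' - c)"
proof -
  have "\<exists>t \<alpha>. t \<in> {1/2 - \<delta>..1/2 + \<delta>} \<and> \<alpha> \<in> {0..1} \<and> tail False t \<alpha> = p" if "p \<in> {0..1}" for p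
    using tail_surj[OF that, of False] by metis
  then obtain T X where TX: "T p \<in> {1/2 - \<delta>..1/2 + \<delta>}" "X p \<in> {0..1}" "tail False (T p) (X p) = p"
    if "p \<in> {0..1}" for p by metis
  define g where "g p = tail True (T p) (X p)" for p
  have ge: "p \<le> g p" if "p \<in> {0..1}" for p
    using tail_False_le_True[OF TX(2)[OF that], of "T p"] TX(3)[OF that] by (simp add: g_def)
  have g1: "g 1 = 1"
    using ge[of 1] tail_bounds[OF TX(2), of 1 True "T 1"] by (simp add: g_def)
  have lip: "\<bar>g p - g q\<bar> \<le> 2 * \<bar>p - q\<bar>" if "p \<in> {0..1}" "q \<in> {0..1}" for p q
    using tail_lipschitz[OF TX(2)[OF that(1)] TX(2)[OF that(2)], of "T p" "T q"] that
    by (simp add: g_def TX)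
  \<comment> \<open>The rule chosen for level 0 may differ from the one that never accepts; the
    Lipschitz bound shows that both have power 0.\<close>
  have g0: "g 0 = 0"
  proof -
    have "tail False (1/2 + \<delta>) 0 = (LINT s|D False. 0)" "tail True (1/2 + \<delta>) 0 = (LINT s|D True. 0)"
      unfolding tail_def
      by (intro integral_cong_AE AE_supportI; simp add: thr_def)+
    then show ?thesis
      using tail_lipschitz[OF TX(2)[of 0], of 0 "T 0" "1/2 + \<delta>"] TX(3)[of 0] by (simp add: g_def)
  qed
  have cont: "continuous_on {0..1} g"
    using lip by (intro lipschitz_on_continuous_on[of 2] lipschitz_onI) (auto simp: dist_real_def)
  note cross = interleaved_curves_cross[OF cont g1 ge g0, simplified]
  \<comment> \<open>Type 2 reduces to type 1 by negating all payoffs, type 3 by exchanging the two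
    segments, type 4 by doing both.\<close>
  have neg_curve: "p * (e - e') - e = q * (f - f') - f \<longleftrightarrow> e + p * (e' - e) = f + q * (f' - f)"
    for e e' f f' p q :: real
    by (auto simp: algebra_simps)
  have "\<exists>p\<in>{0..1}. \<exists>q\<in>{0..1}. b + p * (b' - b) = c + q * (c' - c) \<and>
           b + g p * (b' - b) = c + g q * (c' - c)"
    using assms unfolding interleaved_def
  proof (elim disjE conjE)
    assume "c' < b'" "b' < c" "c < b"
    then show ?thesis
      using cross[of "- b" "- c" "- b'" "- c'"] by (simp add: neg_curve)
  next
    assume "c < b" "b < c'" "c' < b'"
    then show ?thesis using cross[of c b c' b'] by simp metis
  next
    assume "b' < c'" "c' < b" "b < c"
    then show ?thesis
      using cross[of "- c" "- b" "- c'" "- b'"] by (simp add: neg_curve) metis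
  qed (use cross[of b c b' c'] in simp)
  then obtain p q where pq: "p \<in> {0..1}" "q \<in> {0..1}" "b + p * (b' - b) = c + q * (c' - c)"
    "b + g p * (b' - b) = c + g q * (c' - c)" by blast
  have "b + tail \<omega> (T p) (X p) * (b' - b) = c + tail \<omega> (T q) (X q) * (c' - c)" for \<omega>
    using pq by (cases \<omega>) (auto simp: TX g_def)
  then show thesis using that TX pq(1,2) by blast
qed

end

section \<open>Equilibria near the cutoffs\<close>

lemma bayes_denominator_pos:
  assumes "q \<in> {0..1}" "0 < s" "s < (1::real)"
  shows "0 < q * s + (1 - q) * (1 - s)"
proof (cases "q = 0")
  case False
  then have "0 < q * s" "0 \<le> (1 - q) * (1 - s)" using assms by auto
  then show ?thesis by linarith
qed (use assms in simp)

lemma one_minus_bayes_update: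
  assumes "q \<in> {0..1}" "0 < s" "s < 1"
  shows "1 - bayes_update q s = (1 - q) * (1 - s) / (q * s + (1 - q) * (1 - s))"
  using bayes_denominator_pos[OF assms] by (simp add: bayes_update_def field_simps)

lemma bayes_update_range:
  assumes "q \<in> {0..1}" "0 < s" "s < 1"
  shows "bayes_update q s \<in> {0..1}"
proof -
  have "0 \<le> bayes_update q s" "0 \<le> 1 - bayes_update q s"
    unfolding one_minus_bayes_update[OF assms] unfolding bayes_update_def
    using bayes_denominator_pos[OF assms] assms by auto
  then show ?thesis by simp
qed

text \<open>The change of belief is \<open>q * (1 - q) * (2 * s - 1)\<close> over the denominator.
  As the latter is a convex combination of numbers at least 3/8, the change is at most
  \<open>4/3 * \<delta>\<close> in absolute value.\<close>

lemma bayes_update_near: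
  assumes q: "q \<in> {0..1}" and \<delta>: "\<delta> \<le> 1/8" and s: "s \<in> {1/2 - \<delta>..1/2 + \<delta>}"
  shows "\<bar>bayes_update q s - q\<bar> \<le> 2 * \<delta>"
proof -
  let ?D = "q * s + (1 - q) * (1 - s)"
  have "q * (3/8) + (1 - q) * (3/8) \<le> ?D"
    using q s \<delta> by (intro add_mono mult_left_mono) auto
  moreover have "q * (3/8) + (1 - q) * (3/8) = 3/8" by (simp add: field_simps)
  ultimately have D: "3/8 \<le> ?D" by linarith
  have "bayes_update q s - q = q * (1 - q) * (2 * s - 1) / ?D"
    using D by (simp add: bayes_update_def field_simps)
  then have "\<bar>bayes_update q s - q\<bar> = q * (1 - q) * \<bar>2 * s - 1\<bar> / ?D"
    using q D by (simp add: abs_mult)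
  also have "\<dots> \<le> q * (1 - q) * \<bar>2 * s - 1\<bar> / (3/8)"
    using q D by (intro divide_left_mono) auto
  also have "\<dots> \<le> 1/4 * (2 * \<delta>) / (3/8)"
  proof -
    have "q * (1 - q) = 1/4 - (q - 1/2)\<^sup>2" by (simp add: power2_eq_square algebra_simps)
    then have "q * (1 - q) \<le> 1/4" by simp
    moreover have "\<bar>2 * s - 1\<bar> \<le> 2 * \<delta>" using s by auto
    ultimately show ?thesis using q by (intro divide_right_mono mult_mono) auto
  qed
  also have "\<dots> \<le> 2 * \<delta>" using s by auto
  finally show ?thesis .
qed

text \<open>Lets a threshold on beliefs be read as a threshold on signals.\<close>

lemma bayes_update_less_iff:
  assumes "0 < q" "q < 1" "0 < s" "s < 1" "0 < t" "t < 1"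
  shows "bayes_update q s < bayes_update q t \<longleftrightarrow> s < t"
proof -
  have D: "0 < q * s + (1 - q) * (1 - s)" "0 < q * t + (1 - q) * (1 - t)"
    using assms bayes_denominator_pos by auto
  have "bayes_update q s < bayes_update q t \<longleftrightarrow> 0 < q * (1 - q) * (t - s)"
    using D unfolding bayes_update_def by (simp add: divide_less_eq less_divide_eq) (simp add: field_simps)
  also have "\<dots> \<longleftrightarrow> s < t"
  proof -
    have "0 < Q * (t - s) \<longleftrightarrow> s < t" if "0 < Q" for Q
      using that by (simp add: zero_less_mult_iff)
    then show ?thesis using assms by simp
  qed
  finally show ?thesis .
qed

text \<open>The likelihood ratios of \<open>1 - t\<close> and \<open>t\<close> are inverse to each
  other, so the two updates cancel.\<close>

lemma bayes_update_opposite_signal: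
  assumes "0 < q" "q < 1" "0 < t" "t < 1"
  shows "bayes_update (bayes_update q (1 - t)) t = q"
proof -
  define E where "E = q * (1 - t) + (1 - q) * t"
  have E: "0 < E" using bayes_denominator_pos[of q "1 - t"] assms by (simp add: E_def)
  define p where "p = bayes_update q (1 - t)"
  \<comment> \<open>The common factor of the two unnormalised weights after both updates; it drops
    out on normalising.\<close>
  define r where "r = t * (1 - t) / E"
  have r: "0 < r" using assms E by (simp add: r_def)
  have "p * t = q * r"
    by (simp add: p_def r_def bayes_update_def E_def)
  moreover have "(1 - p) * (1 - t) = (1 - q) * r"
    using one_minus_bayes_update[of q "1 - t"] assms by (simp add: p_def r_def E_def)
  ultimately have "bayes_update p t = q * r / (q * r + (1 - q) * r)"
    by (simp add: bayes_update_def)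
  then show ?thesis using r by (simp add: ring_distribs[symmetric] p_def)
qed

lemma segment_ge_min:
  fixes b b' p v :: real
  assumes "p \<in> {0..1}" "v \<le> b" "v \<le> b'"
  shows "v \<le> b + p * (b' - b)"
  using convex_bound_le[of "-b" "-v" "-b'" "1 - p" p] assms by (simp add: algebra_simps)

section \<open>Optimal actions as a function of the receiver's belief\<close>

locale cutoff_problem =
  fixes l j :: nat and a :: "nat \<Rightarrow> 'a" and A :: "'a set"
    and uR :: "'a \<Rightarrow> bool \<Rightarrow> real" and uS :: "'a \<Rightarrow> real" and x :: "nat \<Rightarrow> real" and pr :: real
  assumes A_eq: "A = a ` {1..l}"
    and cutoffs: "x 0 = 0" "x l = 1" "\<And>i. i < l \<Longrightarrow> x i < x (i + 1)"
    and optimal: "\<And>i. i \<in> {1..l} \<Longrightarrow>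
          {q \<in> {0..1}. a i \<in> optimal_actions A uR q} = {x (i - 1)..x i}"
    and prior: "0 < pr" "pr < 1" "j \<in> {1..l}"
begin

lemma x_less: "i < k \<Longrightarrow> k \<le> l \<Longrightarrow> x i < x k"
proof (induction k)
  case (Suc k)
  then have "x k < x (Suc k)" using cutoffs(3)[of k] by simp
  with Suc show ?case by (cases "i = k") (auto intro: less_trans)
qed simp

lemma x_le: "i \<le> k \<Longrightarrow> k \<le> l \<Longrightarrow> x i \<le> x k"
  using x_less[of i k] by (cases "i = k") auto

text \<open>A cutoff \<open>x i\<close> with \<open>1 \<le> i\<close> belongs to the lower interval;
  the guard \<open>1 \<le> i\<close> places belief 0 in the first one.\<close>

definition idx :: "real \<Rightarrow> nat" where
  "idx q = (LEAST i. 1 \<le> i \<and> q \<le> x i)"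

lemma idx_eq:
  assumes "1 \<le> i" "i \<le> l" "x (i - 1) < q" "q \<le> x i"
  shows "idx q = i"
  unfolding idx_def
proof (rule Least_equality)
  fix k assume k: "1 \<le> k \<and> q \<le> x k"
  show "i \<le> k"
  proof (rule ccontr)
    assume "\<not> i \<le> k"
    then have "x k \<le> x (i - 1)" using assms(2) by (intro x_le) auto
    with assms(3) k show False by simp
  qed
qed (use assms in simp)

lemma idx_zero: "idx 0 = 1"
  unfolding idx_def
  by (rule Least_equality) (use x_le[of 0 1] prior cutoffs in auto)

lemma idx_one: "idx 1 = l"
  using x_less[of "l - 1" l] prior cutoffs by (intro idx_eq) auto

lemma idx_bounds:
  assumes q: "q \<in> {0..1}"
  shows "1 \<le> idx q" "idx q \<le> l" "x (idx q - 1) \<le> q" "q \<le> x (idx q)"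
proof -
  have "1 \<le> l \<and> q \<le> x l" using prior cutoffs q by auto
  from LeastI[of "\<lambda>i. 1 \<le> i \<and> q \<le> x i", OF this] Least_le[of "\<lambda>i. 1 \<le> i \<and> q \<le> x i", OF this]
  show i: "1 \<le> idx q" "idx q \<le> l" "q \<le> x (idx q)" by (auto simp: idx_def)
  show "x (idx q - 1) \<le> q"
  proof (cases "idx q = 1")
    case True then show ?thesis using q cutoffs by simp
  next
    case False
    then have "\<not> (1 \<le> idx q - 1 \<and> q \<le> x (idx q - 1))"
      using i(1) not_less_Least[of "idx q - 1" "\<lambda>i. 1 \<le> i \<and> q \<le> x i"] by (simp add: idx_def)
    then show ?thesis using False i(1) by auto
  qed
qed

lemma idx_measurable [measurable]: "idx \<in> borel \<rightarrow>\<^sub>M count_space UNIV"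
  unfolding idx_def by measurable

text \<open>At an interior cutoff two actions are optimal, and the upper one is played with probability \<open>\<alpha>\<close>.\<close>

definition response :: "real \<Rightarrow> real \<Rightarrow> 'a pmf" where
  "response \<alpha> q = map_pmf (\<lambda>b. a (if b \<and> q = x (idx q) \<and> idx q < l then idx q + 1 else idx q)) (bernoulli_pmf \<alpha>)"

lemma set_response:
  assumes q: "q \<in> {0..1}"
  shows "set_pmf (response \<alpha> q) \<subseteq> A \<inter> optimal_actions A uR q"
proof -
  have "a i \<in> A \<inter> optimal_actions A uR q" if i: "i \<in> {1..l}" "q \<in> {x (i - 1)..x i}" for i
  proof -
    have "q \<in> {q \<in> {0..1}. a i \<in> optimal_actions A uR q}" using optimal[OF i(1)] i(2) by simp
    then show ?thesis using i(1) by (simp add: A_eq)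
  qed
  note opt = this
  have "a (idx q) \<in> A \<inter> optimal_actions A uR q"
    using idx_bounds[OF q] by (intro opt) auto
  moreover have "a (idx q + 1) \<in> A \<inter> optimal_actions A uR q" if "q = x (idx q)" "idx q < l"
    using that x_le[of "idx q" "idx q + 1"] by (intro opt) auto
  ultimately show ?thesis by (auto simp: response_def split: if_splits)
qed

lemma expectation_response:
  fixes h :: "'a \<Rightarrow> real"
  assumes "\<alpha> \<in> {0..1}"
  shows "measure_pmf.expectation (response \<alpha> q) h =
    (if q = x (idx q) \<and> idx q < l then \<alpha> * h (a (idx q + 1)) + (1 - \<alpha>) * h (a (idx q)) else h (a (idx q)))"
  using assms by (simp add: response_def integral_map_pmf integral_bernoulli_pmf algebra_simps)

lemma expectation_response_measurable:
  fixes h :: "'a \<Rightarrow> real"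
  assumes "\<alpha> \<in> {0..1}"
  shows "(\<lambda>q. measure_pmf.expectation (response \<alpha> q) h) \<in> borel_measurable borel"
proof -
  have [measurable]: "(\<lambda>q. k (idx q)) \<in> borel_measurable borel" for k :: "nat \<Rightarrow> real"
    using measurable_compose[OF idx_measurable, of k borel] by simp
  show ?thesis
    unfolding expectation_response[OF assms] by measurable
qed

lemma expectation_response_interior:
  assumes "\<alpha> \<in> {0..1}" "1 \<le> i" "i \<le> l" "x (i - 1) < q" "q < x i"
  shows "measure_pmf.expectation (response \<alpha> q) uS = uS (a i)"
  using assms idx_eq[of i q] by (simp add: expectation_response)

text \<open>Between the neighbouring cutoffs only actions \<open>c\<close> and \<open>c + 1\<close>
  are played, so the payoff is a threshold rule in the belief.\<close>

lemma expectation_response_near_cutoff: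
  assumes \<alpha>: "\<alpha> \<in> {0..1}" and c: "1 \<le> c" "c < l" and q: "x (c - 1) < q" "q < x (c + 1)"
  shows "measure_pmf.expectation (response \<alpha> q) uS
       = uS (a c) + thr (x c) \<alpha> q * (uS (a (c + 1)) - uS (a c))"
proof (cases "q \<le> x c")
  case True
  then have "idx q = c" using c q by (intro idx_eq) auto
  with True c \<alpha> show ?thesis by (auto simp: expectation_response thr_def algebra_simps)
next
  case False
  then have "idx q = c + 1" using c q by (intro idx_eq) auto
  with False q \<alpha> show ?thesis by (auto simp: expectation_response thr_def)
qed

text \<open>A message is its own posterior, so the signal updates \<open>m\<close> itself. The
  weight depends on the message, which gives every message its own randomised threshold
  rule.\<close>

definition receiver :: "(real \<Rightarrow> real) \<Rightarrow> 'a receiver_strategy" where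
  "receiver f m s = response (f m) (bayes_update m s)"

end

text \<open>\<open>\<delta>\<close> is so small that after a message within \<open>2 * \<delta>\<close> of a cutoff no signal in the support
  takes the belief to another cutoff.\<close>

locale small_info_problem = cutoff_problem + small_info +
  assumes gap: "\<And>i. i \<in> {1..l} \<Longrightarrow> 4 * \<delta> < x i - x (i - 1)"
    and prior_gap: "x (j - 1) + 2 * \<delta> < pr" "pr + 2 * \<delta> < x j"
begin

section \<open>From incentive constraints to lower bounds on the value\<close>

lemma bayes_measurable [measurable]: "bayes_update m \<in> borel_measurable borel"
  unfolding bayes_update_def by measurable

lemma receiver_expectation_measurable:
  fixes h :: "'a \<Rightarrow> real"
  assumes "\<And>m. f m \<in> {0..1}"
  shows "(\<lambda>s. measure_pmf.expectation (receiver f m s) h) \<in> borel_measurable borel"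
  unfolding receiver_def
  using measurable_compose[OF bayes_measurable expectation_response_measurable[OF assms]] .

lemma receiver_strategy:
  assumes M: "M \<subseteq> {0..1}" and f: "\<And>m. f m \<in> {0..1}"
  shows "is_receiver_strategy A F M (receiver f)"
  unfolding is_receiver_strategy_def
proof (intro conjI ballI)
  fix m s assume "m \<in> M" "s \<in> signals F"
  then have "bayes_update m s \<in> {0..1}"
    using M signal_in_01[of s] by (intro bayes_update_range) auto
  then show "set_pmf (receiver f m s) \<subseteq> A"
    using set_response[of "bayes_update m s" "f m"] by (simp add: receiver_def)
next
  fix m b
  have "(\<lambda>s. measure_pmf.expectation (receiver f m s) (indicator {b} :: 'a \<Rightarrow> real)) \<in> borel_measurable borel"
    by (rule receiver_expectation_measurable) (rule f)
  then show "(\<lambda>s. pmf (receiver f m s) b) \<in> borel_measurable (restrict_space borel (signals F))"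
    by (intro measurable_restrict_space1) (simp add: measure_pmf_single)
qed

text \<open>The receiver best responds by construction of \<open>response\<close>, and the ex-ante
  payoff averages the payoffs of messages sent in each state, so a common lower bound
  \<open>v\<close> on these carries over to it and then to the supremum.\<close>

lemma equilibriumI:
  assumes \<sigma>: "is_sender_strategy pr M \<sigma>" and f: "\<And>m. f m \<in> {0..1}"
    and ic: "\<And>m m' \<omega>. m \<in> M \<Longrightarrow> m' \<in> M \<Longrightarrow> 0 < pmf (\<sigma> \<omega>) m \<Longrightarrow>
      interim_payoff uS F (receiver f) \<omega> m' \<le> interim_payoff uS F (receiver f) \<omega> m"
    and v: "\<And>m \<omega>. m \<in> M \<Longrightarrow> 0 < pmf (\<sigma> \<omega>) m \<Longrightarrow> v \<le> interim_payoff uS F (receiver f) \<omega> m"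
  shows "ereal v \<le> max_value A uR uS F pr"
proof -
  have M: "finite M" "M \<subseteq> {0..1}" "\<And>\<omega>. set_pmf (\<sigma> \<omega>) \<subseteq> M"
      "\<And>m. m \<in> M \<Longrightarrow> 0 < message_prob pr \<sigma> m \<Longrightarrow> message_posterior pr \<sigma> m = m"
    using \<sigma> by (auto simp: is_sender_strategy_def)
  have "cheap_talk_equilibrium A uR uS F pr M \<sigma> (receiver f)"
    unfolding cheap_talk_equilibrium_def
  proof (intro conjI ballI impI allI \<sigma> receiver_strategy[OF M(2) f])
    fix m s assume m: "m \<in> M" "0 < message_prob pr \<sigma> m" and s: "s \<in> signals F"
    have "bayes_update m s \<in> {0..1}"
      using M(2) m(1) signal_in_01[OF s] by (intro bayes_update_range) auto
    then show "set_pmf (receiver f m s) \<subseteq> optimal_actions A uR (bayes_update (message_posterior pr \<sigma> m) s)"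
      using set_response[of "bayes_update m s" "f m"] M(4)[OF m] by (simp add: receiver_def)
  qed (use ic in auto)
  then have "ereal (ex_ante_payoff uS F pr M \<sigma> (receiver f)) \<le> max_value A uR uS F pr"
    unfolding max_value_def by (intro Sup_upper) auto
  moreover have "v \<le> ex_ante_payoff uS F pr M \<sigma> (receiver f)"
  proof -
    have "v \<le> (\<Sum>m\<in>M. pmf (\<sigma> \<omega>) m * interim_payoff uS F (receiver f) \<omega> m)" for \<omega>
    proof -
      have "v = (\<Sum>m\<in>M. pmf (\<sigma> \<omega>) m * v)"
        using sum_pmf_eq_1[OF M(1) M(3)[of \<omega>]] by (simp add: sum_distrib_right[symmetric])
      also have "\<dots> \<le> (\<Sum>m\<in>M. pmf (\<sigma> \<omega>) m * interim_payoff uS F (receiver f) \<omega> m)"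
      proof (rule sum_mono)
        fix m assume "m \<in> M"
        then show "pmf (\<sigma> \<omega>) m * v \<le> pmf (\<sigma> \<omega>) m * interim_payoff uS F (receiver f) \<omega> m"
          using v[of m \<omega>] pmf_nonneg[of "\<sigma> \<omega>" m]
          by (cases "pmf (\<sigma> \<omega>) m = 0") (auto intro!: mult_left_mono)
      qed
      finally show ?thesis .
    qed
    then have "pr * v + (1 - pr) * v \<le> ex_ante_payoff uS F pr M \<sigma> (receiver f)"
      using prior unfolding ex_ante_payoff_def prior_prob_def UNIV_bool
      by (simp add: add.commute) (intro add_mono mult_left_mono; simp)
    then show ?thesis by (simp add: algebra_simps)
  qed
  ultimately show ?thesis by (meson ereal_less_eq(3) order_trans)
qed

text \<open>Every split of the prior into two posteriors comes from a sender strategy. The guards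
  reflect that message 0 is never sent in state \<open>True\<close> and message 1 never in state
  \<open>False\<close>. The bound \<open>v\<close> reaches the remaining messages in use through the
  incentive constraints.\<close>

lemma two_message_value:
  assumes m: "0 \<le> m1" "m1 < pr" "pr < m2" "m2 \<le> 1" and f: "\<And>m. f m \<in> {0..1}"
    and U: "\<And>\<omega> m. U \<omega> m = interim_payoff uS F (receiver f) \<omega> m"
    and ic: "U True m1 \<le> U True m2" "0 < m1 \<Longrightarrow> U True m2 \<le> U True m1"
      "U False m2 \<le> U False m1" "m2 < 1 \<Longrightarrow> U False m1 \<le> U False m2"
    and v: "v \<le> U True m2" "v \<le> U False m1"
  shows "ereal v \<le> max_value A uR uS F pr"
proof -
  \<comment> \<open>Total probability of \<open>m2\<close>, forced by the posteriors averaging to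
    the prior.\<close>
  define w where "w = (pr - m1) / (m2 - m1)"
  have w_diff: "w * (m2 - m1) = pr - m1" using m by (simp add: w_def)
  have w: "0 < w" "w < 1" "pr = (1 - w) * m1 + w * m2"
  proof -
    show "0 < w" "w < 1" using m by (simp_all add: w_def)
    show "pr = (1 - w) * m1 + w * m2" using w_diff by (simp add: algebra_simps)
  qed
  \<comment> \<open>Bayes' rule: the probability of sending \<open>m2\<close> in state
    \<open>\<omega>\<close> that makes its posterior \<open>m2\<close>.\<close>
  define p where "p \<omega> = (if \<omega> then w * m2 / pr else w * (1 - m2) / (1 - pr))" for \<omega>
  have "pr * p True = w * m2" using prior by (simp add: p_def)
  then have pT: "pr * p True = w * m2" "pr * (1 - p True) = (1 - w) * m1"
    using w(3) by (simp_all add: right_diff_distrib)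
  have pF: "(1 - pr) * p False = w * (1 - m2)" using prior by (simp add: p_def)
  have "(1 - pr) * (1 - p False) = (1 - pr) - w * (1 - m2)"
    unfolding pF[symmetric] by (simp add: algebra_simps)
  also have "\<dots> = (1 - w) * (1 - m1)" using w(3) by (simp add: algebra_simps)
  finally have pF': "(1 - pr) * (1 - p False) = (1 - w) * (1 - m1)" .
  have p: "0 \<le> p \<omega>" "p \<omega> \<le> 1" for \<omega>
  proof -
    have "0 \<le> pr * p True" "0 \<le> pr * (1 - p True)" "0 \<le> (1 - pr) * p False" "0 \<le> (1 - pr) * (1 - p False)"
      unfolding pT pF pF' using m w prior by auto
    then show "0 \<le> p \<omega>" "p \<omega> \<le> 1"
      using prior by (cases \<omega>; simp add: zero_le_mult_iff)+
  qed
  define g where "g b = (if b then m2 else m1)" for b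
  have inj: "inj g" using m by (auto simp: g_def inj_def)
  define \<sigma> where "\<sigma> \<omega> = map_pmf g (bernoulli_pmf (p \<omega>))" for \<omega>
  have pmf: "pmf (\<sigma> \<omega>) m2 = p \<omega>" "pmf (\<sigma> \<omega>) m1 = 1 - p \<omega>" for \<omega>
    using pmf_map_inj'[OF inj, of "bernoulli_pmf (p \<omega>)" True] pmf_map_inj'[OF inj, of "bernoulli_pmf (p \<omega>)" False] p[of \<omega>]
    by (simp_all add: \<sigma>_def g_def)
  have prob: "message_prob pr \<sigma> m2 = w" "message_prob pr \<sigma> m1 = 1 - w"
    using pT pF pF' by (simp_all add: message_prob_def prior_prob_def UNIV_bool pmf algebra_simps)
  have post: "message_posterior pr \<sigma> m2 = m2" "message_posterior pr \<sigma> m1 = m1"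
    unfolding message_posterior_def prob using pT w by (simp_all add: prior_prob_def pmf)
  show ?thesis
  proof (rule equilibriumI[where M = "{m1, m2}" and \<sigma> = \<sigma> and f = f])
    show "is_sender_strategy pr {m1, m2} \<sigma>"
      unfolding is_sender_strategy_def using m post by (auto simp: \<sigma>_def g_def)
  next
    fix m assume "m \<in> {m1, m2}"
    fix m' \<omega> assume "m' \<in> {m1, m2}" and pos: "0 < pmf (\<sigma> \<omega>) m"
    have "\<omega> \<Longrightarrow> m = m1 \<Longrightarrow> 0 < m1" "\<not> \<omega> \<Longrightarrow> m = m2 \<Longrightarrow> m2 < 1"
      using pos m pT pF pF' w by (auto simp: pmf p_def zero_less_divide_iff zero_less_mult_iff)
    then show "interim_payoff uS F (receiver f) \<omega> m' \<le> interim_payoff uS F (receiver f) \<omega> m"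
      using \<open>m \<in> _\<close> \<open>m' \<in> _\<close> ic unfolding U[symmetric] by (cases \<omega>) auto
  next
    fix m \<omega> assume "m \<in> {m1, m2}" and pos: "0 < pmf (\<sigma> \<omega>) m"
    have "\<omega> \<Longrightarrow> m = m1 \<Longrightarrow> 0 < m1" "\<not> \<omega> \<Longrightarrow> m = m2 \<Longrightarrow> m2 < 1"
      using pos m pT pF pF' w by (auto simp: pmf p_def zero_less_divide_iff zero_less_mult_iff)
    then show "v \<le> interim_payoff uS F (receiver f) \<omega> m"
      using \<open>m \<in> _\<close> ic v unfolding U[symmetric] by (cases \<omega>) auto
  qed (rule f)
qed

lemma interim_payoff_cong:
  assumes f: "\<And>m. f m \<in> {0..1}" and h: "h \<in> borel_measurable borel"
    and eq: "\<And>s. s \<in> {1/2 - \<delta>..1/2 + \<delta>} \<Longrightarrow> measure_pmf.expectation (receiver f m s) uS = h s"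
  shows "interim_payoff uS F (receiver f) \<omega> m = (LINT s|D \<omega>. h s)"
  unfolding interim_payoff_def
  using receiver_expectation_measurable[OF f] h eq
  by (intro integral_cong_AE AE_supportI) (auto intro: borel_measurable_D)

lemma interim_payoff_interior:
  assumes f: "\<And>m. f m \<in> {0..1}" and i: "1 \<le> i" "i \<le> l" and m: "m \<in> {0..1}" "x (i - 1) + 2 * \<delta> < m" "m + 2 * \<delta> < x i"
  shows "interim_payoff uS F (receiver f) \<omega> m = uS (a i)"
proof -
  have "interim_payoff uS F (receiver f) \<omega> m = (LINT s|D \<omega>. uS (a i))"
  proof (rule interim_payoff_cong[OF f])
    fix s assume "s \<in> {1/2 - \<delta>..1/2 + \<delta>}"
    then have "\<bar>bayes_update m s - m\<bar> \<le> 2 * \<delta>" using bayes_update_near[OF m(1) \<delta>(2)] by simp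
    then show "measure_pmf.expectation (receiver f m s) uS = uS (a i)"
      unfolding receiver_def using m i by (intro expectation_response_interior[OF f]) auto
  qed simp
  then show ?thesis by (simp add: D.prob_space)
qed

text \<open>Signals cannot move a degenerate belief, and \<open>x 1 > 0\<close> excludes mixing at
  0.\<close>

lemma interim_payoff_zero:
  assumes f: "\<And>m. f m \<in> {0..1}"
  shows "interim_payoff uS F (receiver f) \<omega> 0 = uS (a 1)"
proof -
  have "interim_payoff uS F (receiver f) \<omega> 0 = (LINT s|D \<omega>. uS (a 1))"
    using x_less[of 0 1] prior cutoffs
    by (intro interim_payoff_cong[OF f])
      (auto simp: receiver_def bayes_update_def expectation_response[OF f] idx_zero[simplified])
  then show ?thesis by (simp add: D.prob_space)
qed

text \<open>Belief 1 is the last cutoff, where the guard \<open>idx q < l\<close> in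
  \<open>response\<close> excludes mixing.\<close>

lemma interim_payoff_one:
  assumes f: "\<And>m. f m \<in> {0..1}"
  shows "interim_payoff uS F (receiver f) \<omega> 1 = uS (a l)"
proof -
  have "interim_payoff uS F (receiver f) \<omega> 1 = (LINT s|D \<omega>. uS (a l))"
    using \<delta> by (intro interim_payoff_cong[OF f])
      (auto simp: receiver_def bayes_update_def expectation_response[OF f] idx_one[simplified])
  then show ?thesis by (simp add: D.prob_space)
qed

text \<open>The message after which the signal \<open>t\<close> leads exactly to the cutoff \<open>x c\<close>.\<close>

definition msg :: "nat \<Rightarrow> real \<Rightarrow> real" where
  "msg c t = bayes_update (x c) (1 - t)"

context
  fixes c t assumes c: "1 \<le> c" "c < l" and t: "t \<in> {1/2 - \<delta>..1/2 + \<delta>}"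
begin

lemma cutoff_interior: "0 < x c" "x c < 1"
  using x_less[of 0 c] x_less[of c l] c cutoffs by auto

lemma msg_near: "\<bar>msg c t - x c\<bar> \<le> 2 * \<delta>"
  unfolding msg_def using cutoff_interior t by (intro bayes_update_near \<delta>) auto

lemma msg_range: "0 < msg c t" "msg c t < 1"
  unfolding msg_def using lr_bayes_update(1,2)[of "x c" "1 - t"] cutoff_interior t \<delta> by auto

text \<open>Updating is strictly increasing in the signal and takes \<open>t\<close> to
  \<open>x c\<close>, so the threshold rule at the cutoff becomes one at signal
  \<open>t\<close>.\<close>

lemma interim_payoff_msg:
  assumes f: "\<And>m. f m \<in> {0..1}"
  shows "interim_payoff uS F (receiver f) \<omega> (msg c t)
       = uS (a c) + tail \<omega> t (f (msg c t)) * (uS (a (c + 1)) - uS (a c))"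
proof -
  have "interim_payoff uS F (receiver f) \<omega> (msg c t)
      = (LINT s|D \<omega>. uS (a c) + thr t (f (msg c t)) s * (uS (a (c + 1)) - uS (a c)))"
  proof (rule interim_payoff_cong[OF f])
    fix s assume s: "s \<in> {1/2 - \<delta>..1/2 + \<delta>}"
    have s01: "0 < s" "s < 1" "0 < t" "t < 1" using s t \<delta> by auto
    have "\<bar>bayes_update (msg c t) s - msg c t\<bar> \<le> 2 * \<delta>"
      using msg_range s by (intro bayes_update_near \<delta>) auto
    \<comment> \<open>The message is within \<open>2 * \<delta>\<close> of the cutoff and the signal
      adds at most \<open>2 * \<delta>\<close>; this matches the constant in
      \<open>gap\<close>.\<close>
    then have near: "\<bar>bayes_update (msg c t) s - x c\<bar> \<le> 4 * \<delta>" using msg_near by linarith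
    have eq: "bayes_update (msg c t) t = x c"
      unfolding msg_def using cutoff_interior s01 by (intro bayes_update_opposite_signal) auto
    have "thr (x c) \<alpha> (bayes_update (msg c t) s) = thr t \<alpha> s" for \<alpha>
      using bayes_update_less_iff[OF msg_range s01(3,4,1,2)]
        bayes_update_less_iff[OF msg_range s01] eq
      by (auto simp: thr_def)
    then show "measure_pmf.expectation (receiver f (msg c t) s) uS
        = uS (a c) + thr t (f (msg c t)) s * (uS (a (c + 1)) - uS (a c))"
      unfolding receiver_def
      using near gap[of c] gap[of "c + 1"] c
      by (subst expectation_response_near_cutoff[OF f c]) auto
  qed measurable
  also have "\<dots> = uS (a c) + tail \<omega> t (f (msg c t)) * (uS (a (c + 1)) - uS (a c))"
    using thr_integrable[OF f] by (simp add: tail_def D.prob_space)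
  finally show ?thesis .
qed

end

section \<open>The explicit equilibria\<close>

lemma babbling_value: "ereal (uS (a j)) \<le> max_value A uR uS F pr"
proof (rule equilibriumI[where M = "{pr}" and \<sigma> = "\<lambda>_. return_pmf pr" and f = "\<lambda>_. 0"])
  show "is_sender_strategy pr {pr} (\<lambda>_. return_pmf pr)"
    using prior by (simp add: is_sender_strategy_def message_posterior_def message_prob_def prior_prob_def UNIV_bool)
next
  fix m \<omega> assume "m \<in> {pr}"
  then show "uS (a j) \<le> interim_payoff uS F (receiver (\<lambda>_. 0)) \<omega> m"
    using interim_payoff_interior[of "\<lambda>_. 0" j pr \<omega>] prior prior_gap by simp
qed auto

text \<open>Messages near the cutoffs \<open>x i\<close> and \<open>x k\<close> split the prior, and
  at the crossing the sender is indifferent between them in both states. The common payoff lies on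
  both segments, so a lower bound on either one suffices.\<close>

lemma quadruple_value:
  assumes i: "1 \<le> i" "i < j" and k: "j \<le> k" "k < l"
    and inter: "interleaved (uS (a i)) (uS (a (i + 1))) (uS (a k)) (uS (a (k + 1)))"
    and v: "(v \<le> uS (a i) \<and> v \<le> uS (a (i + 1))) \<or> (v \<le> uS (a k) \<and> v \<le> uS (a (k + 1)))"
  shows "ereal v \<le> max_value A uR uS F pr"
proof -
  obtain t \<alpha> u \<beta> where t: "t \<in> {1/2 - \<delta>..1/2 + \<delta>}" "\<alpha> \<in> {0..1}"
    and u: "u \<in> {1/2 - \<delta>..1/2 + \<delta>}" "\<beta> \<in> {0..1}"
    and eq: "\<And>\<omega>. uS (a i) + tail \<omega> t \<alpha> * (uS (a (i + 1)) - uS (a i))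
                = uS (a k) + tail \<omega> u \<beta> * (uS (a (k + 1)) - uS (a k))"
    using indifferent_thresholds[OF inter] by metis
  have il: "i < l" using i k by simp
  have kl: "1 \<le> k" using i k by simp
  have "x i \<le> x (j - 1)" "x j \<le> x k" using x_le i k by auto
  then have lt: "msg i t < pr" "pr < msg k u"
    using msg_near[OF i(1) il t(1)] msg_near[OF kl k(2) u(1)] prior_gap by auto
  \<comment> \<open>The messages lie on different sides of the prior, so each can be given its own
    weight.\<close>
  define f where "f m = (if m = msg i t then \<alpha> else \<beta>)" for m
  have f: "f m \<in> {0..1}" for m using t u by (simp add: f_def)
  define y where "y \<omega> = uS (a i) + tail \<omega> t \<alpha> * (uS (a (i + 1)) - uS (a i))" for \<omega>
  have U: "interim_payoff uS F (receiver f) \<omega> (msg i t) = y \<omega>"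
      "interim_payoff uS F (receiver f) \<omega> (msg k u) = y \<omega>" for \<omega>
    unfolding interim_payoff_msg[where f = f, OF i(1) il t(1) f] interim_payoff_msg[where f = f, OF kl k(2) u(1) f]
    using lt eq[of \<omega>] by (simp_all add: f_def y_def)
  have "v \<le> y \<omega>" for \<omega>
    using v
  proof
    assume "v \<le> uS (a i) \<and> v \<le> uS (a (i + 1))"
    then show ?thesis
      unfolding y_def by (intro segment_ge_min[OF tail_bounds[OF t(2)]]) auto
  next
    assume "v \<le> uS (a k) \<and> v \<le> uS (a (k + 1))"
    then show ?thesis
      unfolding y_def eq by (intro segment_ge_min[OF tail_bounds[OF u(2)]]) auto
  qed
  then show ?thesis
    using lt msg_range[OF i(1) il t(1)] msg_range[OF kl k(2) u(1)]
    by (intro two_message_value[of "msg i t" "msg k u" f, OF _ _ _ _ f refl]) (auto simp: U)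
qed

text \<open>Message 0 reveals state \<open>False\<close>; the other is tuned to make that state
  indifferent. State \<open>True\<close> has the larger tail and hence at least the payoff of
  message 0.\<close>

lemma first_action_value:
  assumes i: "1 < i" "i < l" "j \<le> i" and u: "uS (a i) < uS (a 1)" "uS (a 1) < uS (a (i + 1))"
  shows "ereal (uS (a 1)) \<le> max_value A uR uS F pr"
proof -
  let ?d = "uS (a (i + 1)) - uS (a i)"
  have d: "0 < ?d" using u by simp
  \<comment> \<open>The probability of the upper action at which the interpolated payoff equals that
    of \<open>a 1\<close>.\<close>
  define p where "p = (uS (a 1) - uS (a i)) / ?d"
  have p: "p \<in> {0..1}" "uS (a i) + p * ?d = uS (a 1)" using u d by (auto simp: p_def)
  obtain t \<alpha> where t: "t \<in> {1/2 - \<delta>..1/2 + \<delta>}" "\<alpha> \<in> {0..1}" "tail False t \<alpha> = p"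
    using tail_surj[OF p(1)] by metis
  have i': "1 \<le> i" using i by simp
  have lt: "pr < msg i t" using msg_near[OF i' i(2) t(1)] prior_gap x_le[of j i] i by auto
  define f where "f = (\<lambda>m::real. \<alpha>)"
  have f: "f m \<in> {0..1}" for m using t by (simp add: f_def)
  have U1: "interim_payoff uS F (receiver f) \<omega> (msg i t) = uS (a i) + tail \<omega> t \<alpha> * ?d" for \<omega>
    unfolding interim_payoff_msg[where f = f, OF i' i(2) t(1) f] by (simp add: f_def)
  have "p * ?d \<le> tail True t \<alpha> * ?d"
    using tail_False_le_True[OF t(2), of t] t(3) d by (intro mult_right_mono) auto
  then have T: "uS (a 1) \<le> uS (a i) + tail True t \<alpha> * ?d" using p(2) by linarith
  show ?thesis
    using lt T prior msg_range[OF i' i(2) t(1)] p(2) t(3)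
    by (intro two_message_value[of 0 "msg i t" f, OF _ _ _ _ f refl])
      (auto simp: U1 interim_payoff_zero[where f = f, OF f] simp del: One_nat_def)
qed

text \<open>Mirror image: message 1 reveals state \<open>True\<close>, which is made indifferent by
  a message near \<open>x (i - 1)\<close>, the cutoff between actions \<open>i - 1\<close> and
  \<open>i\<close>. The payoff now falls in the tail, so the smaller tail in state
  \<open>False\<close> is the better one.\<close>

lemma last_action_value:
  assumes i: "1 < i" "i < l" "i \<le> j" and u: "uS (a i) < uS (a l)" "uS (a l) < uS (a (i - 1))"
  shows "ereal (uS (a l)) \<le> max_value A uR uS F pr"
proof -
  let ?c = "i - 1"
  let ?d = "uS (a i) - uS (a ?c)"
  have d: "?d < 0" using u by simp
  define p where "p = (uS (a l) - uS (a ?c)) / ?d"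
  have p: "p \<in> {0..1}" "uS (a ?c) + p * ?d = uS (a l)" using u d by (auto simp: p_def divide_le_eq zero_le_divide_iff)
  obtain t \<alpha> where t: "t \<in> {1/2 - \<delta>..1/2 + \<delta>}" "\<alpha> \<in> {0..1}" "tail True t \<alpha> = p"
    using tail_surj[OF p(1)] by metis
  have c: "1 \<le> ?c" "?c < l" "?c + 1 = i" using i by auto
  have lt: "msg ?c t < pr" using msg_near[OF c(1,2) t(1)] prior_gap x_le[of ?c "j - 1"] i prior by force
  define f where "f = (\<lambda>m::real. \<alpha>)"
  have f: "f m \<in> {0..1}" for m using t by (simp add: f_def)
  have U1: "interim_payoff uS F (receiver f) \<omega> (msg ?c t) = uS (a ?c) + tail \<omega> t \<alpha> * ?d" for \<omega>
    unfolding interim_payoff_msg[where f = f, OF c(1,2) t(1) f] c(3) by (simp add: f_def)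
  have "p * ?d \<le> tail False t \<alpha> * ?d"
    using tail_False_le_True[OF t(2), of t] t(3) d by (intro mult_right_mono_neg) auto
  then have T: "uS (a l) \<le> uS (a ?c) + tail False t \<alpha> * ?d" using p(2) by linarith
  show ?thesis
    using lt T prior msg_range[OF c(1,2) t(1)] p(2) t(3)
    by (intro two_message_value[of "msg ?c t" 1 f, OF _ _ _ _ f refl])
      (auto simp: U1 interim_payoff_one[where f = f, OF f] simp del: One_nat_def)
qed

lemma V_B_le_max_value: "V_B l a uS j \<le> max_value A uR uS F pr"
proof (cases "Q_set l a uS j = {}")
  case True then show ?thesis by (simp add: V_B_def pure_row_value_def)
next
  case False
  let ?R = "Q_set l a uS j" and ?v = "\<lambda>r. min (B_matrix uS r 1) (B_matrix uS r 2)"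
  have "?R \<subseteq> (\<lambda>(i, k). (a i, a (i + 1), a k, a (k + 1))) ` ({..l} \<times> {..l})"
    by (force simp: Q_set_def)
  then have fin: "finite ?R" by (rule finite_subset) simp
  obtain r where r: "r \<in> ?R" "Max (?v ` ?R) = ?v r"
    using Max_in[of "?v ` ?R"] fin False by (auto simp: image_iff)
  from r(1) obtain i k s where ik: "r = (a i, a (i + 1), a k, a (k + 1))" "1 \<le> i" "i \<le> j - 1" "j \<le> k" "k + 1 \<le> l"
    and s: "Q_type uS s r"
    by (auto simp: Q_set_def)
  have "ereal (?v r) \<le> max_value A uR uS F pr"
  proof (rule quadruple_value[of i k])
    show "interleaved (uS (a i)) (uS (a (i + 1))) (uS (a k)) (uS (a (k + 1)))"
      using s by (auto simp: ik(1) Q_type_def interleaved_def)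
    \<comment> \<open>The two entries of a row are the ends of the overlap of the two payoff
      segments, so their minimum is the lower end of one segment.\<close>
    show "(?v r \<le> uS (a i) \<and> ?v r \<le> uS (a (i + 1))) \<or> (?v r \<le> uS (a k) \<and> ?v r \<le> uS (a (k + 1)))"
      using s by (auto simp: ik(1) Q_type_def B_matrix_def)
  qed (use ik in auto)
  then show ?thesis
    using False r(2) by (simp add: V_B_def pure_row_value_def)
qed

lemma bounds_le_max_value:
  "v_first_star l a uS j \<le> max_value A uR uS F pr"
  "v_last_star l a uS j \<le> max_value A uR uS F pr"
  using first_action_value last_action_value
  by (auto simp: v_first_star_def v_last_star_def T_type1_def T_type2_def)

end

section \<open>Passage to the limit of vanishing information\<close>

lemma v_hat_le_v_hat_b: "v_hat A uR uS pr \<le> v_hat_b A uR uS pr"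
proof (rule tendsto_le[OF _ tendsto_v_hat_b tendsto_v_hat])
  show "\<forall>\<^sub>F \<delta> in at_right 0. (INF F\<in>info_delta \<delta>. max_value A uR uS F pr)
      \<le> (INF F\<in>binary_delta \<delta>. max_value A uR uS F pr)"
    by (intro always_eventually allI INF_superset_mono) (auto simp: binary_delta_def)
qed simp

lemma v_hat_ge:
  assumes "0 < d" "\<And>\<delta> F. 0 < \<delta> \<Longrightarrow> \<delta> < d \<Longrightarrow> F \<in> info_delta \<delta> \<Longrightarrow> v \<le> max_value A uR uS F pr"
  shows "v \<le> v_hat A uR uS pr"
proof (rule tendsto_lowerbound[OF tendsto_v_hat])
  show "\<forall>\<^sub>F \<delta> in at_right 0. v \<le> (INF F\<in>info_delta \<delta>. max_value A uR uS F pr)"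
    using eventually_at_right_real[OF assms(1)]
    by eventually_elim (auto intro!: INF_greatest assms(2))
qed simp

theorem theorem4:
  fixes l j :: nat
    and a :: "nat \<Rightarrow> 'a"
    and A :: "'a set"
    and uR :: "'a \<Rightarrow> bool \<Rightarrow> real"
    and uS :: "'a \<Rightarrow> real"
    and x :: "nat \<Rightarrow> real"
    and pr :: real
  assumes actions: "inj_on a {1..l}" "A = a ` {1..l}"
    and cutoffs: "x 0 = 0" "x l = 1" "\<And>i. i < l \<Longrightarrow> x i < x (i + 1)"
    and optimal: "\<And>i. i \<in> {1..l} \<Longrightarrow>
          {q \<in> {0..1}. a i \<in> optimal_actions A uR q} = {x (i - 1)..x i}"
    and generic: "inj_on uS A"
    and prior: "0 < pr" "pr < 1" "j \<in> {1..l}" "pr \<in> interior {x (j - 1)..x j}"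
  shows "Max {v_first_star l a uS j, v_last_star l a uS j, V_B l a uS j, ereal (v_belief l a x uS pr)}
           \<le> v_hat A uR uS pr
         \<and> v_hat A uR uS pr \<le> v_hat_b A uR uS pr"
proof (intro conjI v_hat_le_v_hat_b)
  have pr: "x (j - 1) < pr" "pr < x j" "pr \<in> interior {x (j - 1)..x j}" using prior(4) by auto
  interpret cutoff_problem l j a A uR uS x pr
    by standard (use assms in auto)
  have "v_belief l a x uS pr = uS (a j)"
  proof -
    have "(THE i. i \<in> {1..l} \<and> pr \<in> interior {x (i - 1)..x i}) = j"
    proof (rule the_equality)
      fix i assume "i \<in> {1..l} \<and> pr \<in> interior {x (i - 1)..x i}"
      then show "i = j" using idx_eq[of i pr] idx_eq[of j pr] prior(3) pr by auto
    qed (use prior pr in blast)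
    then show ?thesis by (simp add: v_belief_def)
  qed
  \<comment> \<open>The entry 1/8 serves \<open>small_info\<close>, the halves give
    \<open>prior_gap\<close>, and the quarters give \<open>gap\<close>.\<close>
  moreover define d where "d = Min (insert (1/8) (insert ((pr - x (j - 1)) / 2)
      (insert ((x j - pr) / 2) ((\<lambda>i. (x i - x (i - 1)) / 4) ` {1..l}))))"
  have d: "0 < d" using pr x_less by (auto simp: d_def)
  have "Max {v_first_star l a uS j, v_last_star l a uS j, V_B l a uS j, ereal (uS (a j))}
      \<le> max_value A uR uS F pr"
    if \<delta>: "0 < \<delta>" "\<delta> < d" and F: "F \<in> info_delta \<delta>" for \<delta> F
  proof -
    have small: "\<delta> < 1/8" "\<delta> < (pr - x (j - 1)) / 2" "\<delta> < (x j - pr) / 2"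
      "\<And>i. i \<in> {1..l} \<Longrightarrow> \<delta> < (x i - x (i - 1)) / 4"
      using \<delta>(2) by (auto simp: d_def)
    interpret small_info_problem l j a A uR uS x pr F \<delta>
    proof
    show "4 * \<delta> < x i - x (i - 1)" if "i \<in> {1..l}" for i
      using small(4)[OF that] by simp
  qed (use small \<delta> F in auto)
    show ?thesis
      using bounds_le_max_value V_B_le_max_value babbling_value by simp
  qed
  ultimately show "Max {v_first_star l a uS j, v_last_star l a uS j, V_B l a uS j,
      ereal (v_belief l a x uS pr)} \<le> v_hat A uR uS pr"
    by (simp only: v_hat_ge[OF d])
qed

end
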